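(* Let $\upsilon\in\{1,2,\dots\}$, let $k,s$ be nonnegative integers that are both even or both odd, and let $a,b,c,d$ be real with $a,d>0$, $b>\left[\frac{k}{2}\right]+\frac12$, $c>\left[\frac{s+1}{2}\right]+\frac12$ and $b+c>\max\{k,s\}+1$. Put $$\rho(a,b,c,d;z,t)=\Gamma(a-it)\,\Gamma(d+it)\,\Gamma\!\left(\tfrac14-\tfrac{iz}{2}\right)\Gamma\!\left(\tfrac14+\tfrac{iz}{2}\right)\Gamma\!\left(b-\tfrac12+\tfrac{iz}{2}\right)\Gamma\!\left(c-\tfrac12-\tfrac{iz}{2}\right).$$ Then the families $\Upsilon_1(k,a,b,c,d,\upsilon;\cdot,\cdot)$ and $\Upsilon_2(s,d,c,b,a,\upsilon;\cdot,\cdot)$ are finite biorthogonal functions with respect to the weight $\rho$, with the relation $$\int_{-\infty}^{\infty}\int_{-\infty}^{\infty}\rho(a,b,c,d;z,t)\,\Upsilon_{1}(k,a,b,c,d,\upsilon;iz,it)\,\Upsilon_{2}(s,d,c,b,a,\upsilon;-iz,-it)\,dt\,dz$$ $$=\frac{(-1)^{k}\,2^{2(b+c-k)+1}\,\pi^{2}\,k!\,\Gamma^{2}(b+c-k)\,\Gamma(b-\frac14)\,\Gamma(c-\frac14)}{(b+c-k-1)\,\Gamma(2(b+c)-k-1)}\,\delta_{k,s}.$$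
   Context: $(x)_n$ is the Pochhammer symbol, $[x]$ the integer part, $\delta_{k,s}$ the Kronecker delta, $i$ the imaginary unit. Define $$\Psi_{1}(k,a,b,p,q,\upsilon;\xi_1,\xi_2)=\frac{\left(\frac14-\frac{i\xi_1}{2}\right)_{[k/2]}}{\left(\frac32-b-\frac{i\xi_1}{2}\right)_{[k/2]}}\sum_{l=0}^{[k/2]}\sum_{n=0}^{k-l}\frac{\left(\frac{-k}{2}\right)_l\left(\frac{-k+1}{2}\right)_l(-(k-l))_n\,(a-i\xi_2)_{\upsilon n}\left(b-[\frac k2]-\frac12+\frac{i\xi_1}{2}\right)_l2^{\upsilon n}}{(p-k)_l\,\Gamma(q+\upsilon n+1)\left(\frac34-[\frac k2]+\frac{i\xi_1}{2}\right)_l\,l!\,n!},$$ $$\Psi_{2}(s,d,c,\alpha,\beta,\upsilon;\xi_1,\xi_2)=\frac{\left(\frac14-\frac{i\xi_1}{2}\right)_{[(s+1)/2]}}{\left(\frac32-c-\frac{i\xi_1}{2}\right)_{[(s+1)/2]}}\sum_{l=0}^{[s/2]}\frac{\left(\frac{-s}{2}\right)_l\left(\frac{-s+1}{2}\right)_l\left(c-[\frac{s+1}{2}]-\frac12+\frac{i\xi_1}{2}\right)_l}{\left(\frac34-[\frac{s+1}{2}]+\frac{i\xi_1}{2}\right)_l(\alpha-s)_l\,l!}$$ $$\times\sum_{j=0}^{s}\sum_{r=0}^{j}\sum_{n=0}^{r}\frac{(-r)_n\,(d-i\xi_2)_r\,2^{r}}{j!\,r!\,n!}\left(\frac{\beta+n+1}{\upsilon}\right)_{j},$$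 $$\Upsilon_{1}(k,a,b,c,d,\upsilon;z,t)=2^{a-t}\,\Psi_{1}(k,a,b,b+c,a+d-1,\upsilon;-iz,-it),$$ $$\Upsilon_{2}(s,d,c,b,a,\upsilon;z,t)=2^{d-t}\,\Psi_{2}(s,d,c,c+b,d+a-1,\upsilon;-iz,-it).$$ *)

theory Defs
  imports "HOL-Analysis.Analysis"
begin

(* The arguments are complex, although the weight lives on real pairs, because Upsilon1 and
   Upsilon2 are evaluated on the imaginary axis. The integer parts [k/2] and [(s+1)/2] are
   division on nat. *)

definition Psi1 ::
  "nat \<Rightarrow> real \<Rightarrow> real \<Rightarrow> real \<Rightarrow> real \<Rightarrow> nat \<Rightarrow> complex \<Rightarrow> complex \<Rightarrow> complex" where
  "Psi1 k a b p q \<upsilon> \<xi>\<^sub>1 \<xi>\<^sub>2 =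
     pochhammer (1/4 - \<i> * \<xi>\<^sub>1 / 2) (k div 2)
       / pochhammer (3/2 - of_real b - \<i> * \<xi>\<^sub>1 / 2) (k div 2)
     * (\<Sum>l = 0..k div 2. \<Sum>n = 0..k - l.
          (pochhammer (- of_nat k / 2) l * pochhammer ((- of_nat k + 1) / 2) l
           * pochhammer (- (of_nat k - of_nat l)) n
           * pochhammer (of_real a - \<i> * \<xi>\<^sub>2) (\<upsilon> * n)
           * pochhammer (of_real b - of_nat (k div 2) - 1/2 + \<i> * \<xi>\<^sub>1 / 2) l
           * 2 ^ (\<upsilon> * n))
        / (pochhammer (of_real p - of_nat k) l
           * Gamma (of_real q + of_nat \<upsilon> * of_nat n + 1)
           * pochhammer (3/4 - of_nat (k div 2) + \<i> * \<xi>\<^sub>1 / 2) l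
           * fact l * fact n))"

definition Psi2 ::
  "nat \<Rightarrow> real \<Rightarrow> real \<Rightarrow> real \<Rightarrow> real \<Rightarrow> nat \<Rightarrow> complex \<Rightarrow> complex \<Rightarrow> complex" where
  "Psi2 s d c \<alpha> \<beta> \<upsilon> \<xi>\<^sub>1 \<xi>\<^sub>2 =
     pochhammer (1/4 - \<i> * \<xi>\<^sub>1 / 2) ((s + 1) div 2)
       / pochhammer (3/2 - of_real c - \<i> * \<xi>\<^sub>1 / 2) ((s + 1) div 2)
     * (\<Sum>l = 0..s div 2.
          (pochhammer (- of_nat s / 2) l * pochhammer ((- of_nat s + 1) / 2) l
           * pochhammer (of_real c - of_nat ((s + 1) div 2) - 1/2 + \<i> * \<xi>\<^sub>1 / 2) l)
        / (pochhammer (3/4 - of_nat ((s + 1) div 2) + \<i> * \<xi>\<^sub>1 / 2) l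
           * pochhammer (of_real \<alpha> - of_nat s) l * fact l))
     * (\<Sum>j = 0..s. \<Sum>r = 0..j. \<Sum>n = 0..r.
          (pochhammer (- of_nat r) n * pochhammer (of_real d - \<i> * \<xi>\<^sub>2) r * 2 ^ r)
          / (fact j * fact r * fact n)
          * pochhammer ((of_real \<beta> + of_nat n + 1) / of_nat \<upsilon>) j)"

definition Upsilon1 ::
  "nat \<Rightarrow> real \<Rightarrow> real \<Rightarrow> real \<Rightarrow> real \<Rightarrow> nat \<Rightarrow> complex \<Rightarrow> complex \<Rightarrow> complex" where
  "Upsilon1 k a b c d \<upsilon> z t =
     2 powr (of_real a - t) * Psi1 k a b (b + c) (a + d - 1) \<upsilon> (- \<i> * z) (- \<i> * t)"

definition Upsilon2 ::
  "nat \<Rightarrow> real \<Rightarrow> real \<Rightarrow> real \<Rightarrow> real \<Rightarrow> nat \<Rightarrow> complex \<Rightarrow> complex \<Rightarrow> complex" where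
  "Upsilon2 s d c b a \<upsilon> z t =
     2 powr (of_real d - t) * Psi2 s d c (c + b) (d + a - 1) \<upsilon> (- \<i> * z) (- \<i> * t)"

definition rho :: "real \<Rightarrow> real \<Rightarrow> real \<Rightarrow> real \<Rightarrow> real \<Rightarrow> real \<Rightarrow> complex" where
  "rho a b c d z t =
     Gamma (of_real a - \<i> * of_real t) * Gamma (of_real d + \<i> * of_real t)
     * Gamma (1/4 - \<i> * of_real z / 2) * Gamma (1/4 + \<i> * of_real z / 2)
     * Gamma (of_real b - 1/2 + \<i> * of_real z / 2)
     * Gamma (of_real c - 1/2 - \<i> * of_real z / 2)"

end

theory Submission
  imports Defs "HOL-Probability.Probability"
begin

text \<open>
  Write \<open>K = k div 2\<close>, \<open>n = s div 2\<close>, \<open>S = (s + 1) div 2\<close>, so that \<open>n + S = s\<close>. On the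
  imaginary axis the weight absorbs the Pochhammer symbols of both functions, and the integrand becomes
  \<open>\<Sum>l\<le>K. \<alpha>(l) Z(l, z) T(k - l, t)\<close>. Here \<open>T\<close> is a finite combination of products
  \<open>\<Gamma>(A - it) \<Gamma>(D + it)\<close> and \<open>Z\<close> one of products
  \<open>\<Gamma>(A - iz/2) \<Gamma>(D + iz/2) \<Gamma>(B - iz/2) \<Gamma>(E + iz/2)\<close>, all parameters being positive. Each of these
  is integrable, so everything reduces to one-dimensional integrals and two finite summations.

  The integrals come from one Fourier pair: \<open>\<Gamma>(A - it) \<Gamma>(D + it) / \<Gamma>(A + D)\<close> is the Fourier transform
  of \<open>exp(Ax) (1 + exp x) powr -(A + D)\<close>. Inverting it at the origin gives
  \<open>2 \<pi> \<Gamma>(A + D) 2 powr -(A + D)\<close> for the integral over \<open>t\<close>; pairing two such functions, as in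
  Parseval's formula, gives Barnes' first lemma for the integral over \<open>z\<close>.

  In the variable \<open>t\<close>, write \<open>\<sigma> = a + d\<close>, and let \<open>\<nu>\<close> be the inner summation index of the first
  function. The integrals turn the two innermost sums of the second function into Newton's interpolation
  formula for the polynomial \<open>x \<mapsto> ((\<sigma> + x) / \<upsilon>)_j\<close>, taken at \<open>x = -(\<sigma> + \<upsilon> \<nu>)\<close>, where its value
  is \<open>(-\<nu>)_j\<close>. This is the biorthogonality of the Konhauser
  polynomials; summed over \<open>j \<le> s\<close> it says that \<open>T(N, \<cdot>)\<close> has integral \<open>2 \<pi>\<close> if \<open>N \<le> s\<close> and \<open>0\<close>
  otherwise.

  In the variable \<open>z\<close>, Barnes' lemma turns \<open>Z(l, \<cdot>)\<close> into a multiple of the moment of \<open>x ^ (k - 2l)\<close>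
  against the polynomial of degree \<open>s\<close> that is orthogonal for the weight
  \<open>(1 + x\<^sup>2) powr (1/2 - b - c)\<close> on the real line. Its explicit form is a balanced terminating
  hypergeometric sum, which the Pfaff-Saalschuetz theorem evaluates; the result contains the factor
  \<open>(1 + K - l - n)_n\<close>, which vanishes unless \<open>l \<le> K - n\<close>. As \<open>k\<close> and \<open>s\<close> have the same parity, this
  condition and \<open>k - l \<le> s\<close> are only compatible for \<open>l = 0\<close> and \<open>k = s\<close>. The one surviving term is
  brought into the stated form by two applications of the duplication formula.
\<close>

section \<open>The Gamma function on the right half-plane\<close>

lemma complex_not_nonpos_Int: "Re z > 0 \<Longrightarrow> z \<notin> \<int>\<^sub>\<le>\<^sub>0" for z :: complex
  by (auto elim!: nonpos_Ints_cases)

lemma Gamma_real_nonzero: "x > 0 \<Longrightarrow> Gamma x \<noteq> 0" for x :: real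
  using Gamma_real_pos [of x] by linarith

lemma Gamma_mult_pochhammer:
  fixes z :: "'a::Gamma"
  assumes "z \<notin> \<int>\<^sub>\<le>\<^sub>0"
  shows "Gamma z * pochhammer z n = Gamma (z + of_nat n)"
  using pochhammer_Gamma [OF assms, of n] assms by (simp add: Gamma_eq_zero_iff)

lemma Gamma_mult_pochhammer_complex:
  "Re z > 0 \<Longrightarrow> Gamma z * pochhammer z n = Gamma (z + of_nat n)" for z :: complex
  by (rule Gamma_mult_pochhammer [OF complex_not_nonpos_Int])

lemma Gamma_mult_pochhammer_real:
  "x > 0 \<Longrightarrow> Gamma x * pochhammer x n = Gamma (x + of_nat n)" for x :: real
  by (rule Gamma_mult_pochhammer) (auto elim!: nonpos_Ints_cases)

text \<open>
  Moving a Pochhammer symbol across a Gamma function only shifts the argument, and the reflection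
  \<open>(-x)_n = (-1)^n (x - n + 1)_n\<close> does the same for the symbols in the denominators. Both functions of
  the biorthogonal pair carry quotients of this form, with \<open>u + v\<close> independent of \<open>z\<close>; this is how the
  weight clears all denominators that depend on \<open>z\<close>.
\<close>

lemma Gamma_ratio_shift:
  fixes u v :: complex
  assumes "l \<le> K" and u: "Re u > 0" and v: "Re v > real K"
  shows "Gamma u * Gamma v * (pochhammer u K / pochhammer (1 - v) K)
           * (pochhammer (v - of_nat K) l / pochhammer (1 - u - of_nat K) l)
         = (-1) ^ (K + l) * Gamma (u + of_nat K - of_nat l) * Gamma (v - of_nat K + of_nat l)"
proof -
  have nz: "pochhammer z n \<noteq> 0" if "Re z > 0" for z :: complex and n
    using that by (auto simp: pochhammer_eq_0_iff)
  define u' v' where "u' = u + of_nat K - of_nat l" and "v' = v - of_nat K"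
  have u': "Re u' > 0" and v': "Re v' > 0"
    using assms by (auto simp: u'_def v'_def)
  have "pochhammer (1 - v) K = (-1) ^ K * pochhammer v' K"
    using pochhammer_minus [of "v - 1" K] by (simp add: v'_def algebra_simps)
  moreover have "pochhammer (1 - u - of_nat K) l = (-1) ^ l * pochhammer u' l"
    using pochhammer_minus [of "u + of_nat K - 1" l] by (simp add: u'_def algebra_simps)
  moreover have "Gamma u * pochhammer u K = Gamma u' * pochhammer u' l"
    using Gamma_mult_pochhammer_complex [OF u, of K] Gamma_mult_pochhammer_complex [OF u', of l] by (simp add: u'_def)
  moreover have "Gamma v = Gamma v' * pochhammer v' K"
    using Gamma_mult_pochhammer_complex [OF v', of K] by (simp add: v'_def)
  ultimately have eqs: "pochhammer (1 - v) K = (-1) ^ K * pochhammer v' K"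
      "pochhammer (1 - u - of_nat K) l = (-1) ^ l * pochhammer u' l"
      "Gamma u * pochhammer u K = Gamma u' * pochhammer u' l"
      "Gamma v = Gamma v' * pochhammer v' K"
    by blast+
  have "Gamma u * Gamma v * (pochhammer u K / pochhammer (1 - v) K)
           * (pochhammer (v - of_nat K) l / pochhammer (1 - u - of_nat K) l)
     = (Gamma u * pochhammer u K) * Gamma v * pochhammer v' l
          / (pochhammer (1 - v) K * pochhammer (1 - u - of_nat K) l)"
    by (simp add: v'_def)
  also have "\<dots> = (Gamma u' * pochhammer u' l) * (Gamma v' * pochhammer v' K) * pochhammer v' l
          / ((-1) ^ K * pochhammer v' K * ((-1) ^ l * pochhammer u' l))"
    by (simp only: eqs)
  also have "\<dots> = (-1) ^ (K + l) * Gamma u' * (Gamma v' * pochhammer v' l)"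
    using nz [OF u', of l] nz [OF v', of K] by (simp add: power_add field_simps)
  finally show ?thesis
    using Gamma_mult_pochhammer_complex [OF v', of l] by (simp add: u'_def v'_def)
qed

lemma Gamma_duplication_real:
  fixes x :: real
  assumes "x > 0"
  shows "Gamma x * Gamma (x + 1/2) = 2 powr (1 - 2 * x) * sqrt pi * Gamma (2 * x)"
proof -
  have "complex_of_real x \<notin> \<int>\<^sub>\<le>\<^sub>0" "complex_of_real x + 1/2 \<notin> \<int>\<^sub>\<le>\<^sub>0"
    using assms by (auto intro!: complex_not_nonpos_Int)
  from Gamma_legendre_duplication [OF this]
  have "Gamma (complex_of_real x) * Gamma (complex_of_real (x + 1/2))
          = complex_of_real (exp ((1 - 2 * x) * ln 2)) * of_real (sqrt pi) * Gamma (complex_of_real (2 * x))"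
    by (simp add: exp_of_real [symmetric])
  then show ?thesis
    unfolding Gamma_complex_of_real of_real_mult [symmetric] of_real_eq_iff by (simp add: powr_def)
qed

lemma has_bochner_integral_of_realD:
  assumes "has_bochner_integral M (\<lambda>x. complex_of_real (f x)) (of_real c)"
  shows "has_bochner_integral M f c"
  using has_bochner_integral_bounded_linear [OF bounded_linear_Re assms] by simp

text \<open>
  Euler's integral after the substitution \<open>t = exp x\<close>. On the whole line the dependence on \<open>z\<close> becomes
  exponential, so that vertical lines in \<open>z\<close> correspond to Fourier transforms.
\<close>

lemma has_bochner_integral_Gamma_exp:
  assumes "Re z > 0"
  shows "has_bochner_integral lborel (\<lambda>x::real. exp (z * of_real x - of_real (exp x))) (Gamma z)"
proof -
  define f where "f = (\<lambda>t::real. complex_of_real t powr (z - 1) / of_real (exp t))"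
  define g where "g = (\<lambda>x::real. exp (z * of_real x - of_real (exp x)))"
  have range: "range exp = {0::real<..}"
    by (auto simp: image_iff) (metis exp_ln)
  have g_eq: "\<bar>exp x\<bar> *\<^sub>R f (exp x) = g x" for x
  proof -
    have "Ln (complex_of_real (exp x)) = of_real x"
      by (subst Ln_of_real) auto
    then show ?thesis
      by (simp add: f_def g_def powr_def scaleR_conv_of_real exp_diff ring_distribs flip: exp_of_real)
  qed
  have "f absolutely_integrable_on range exp \<and> integral (range exp) f = Gamma z"
    unfolding range f_def
    using absolutely_integrable_Gamma_integral' [OF assms] Gamma_integral_complex' [OF assms]
    by (auto simp: has_integral_iff)
  then have "(\<lambda>x. \<bar>exp x\<bar> *\<^sub>R f (exp x)) absolutely_integrable_on UNIV \<and>
             integral UNIV (\<lambda>x. \<bar>exp x\<bar> *\<^sub>R f (exp x)) = Gamma z"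
    by (subst has_absolute_integral_change_of_variables_real)
       (auto intro!: derivative_eq_intros injI)
  then have g: "integrable lebesgue g" "integral UNIV g = Gamma z"
    unfolding g_eq by (auto simp: set_integrable_def)
  have "g \<in> borel_measurable borel"
    unfolding g_def by (intro borel_measurable_continuous_onI continuous_intros)
  with g(1) have "integrable lborel g"
    by (simp add: integrable_completion)
  with g(2) show ?thesis
    unfolding g_def by (simp add: has_bochner_integral_iff integral_lborel)
qed

lemma has_bochner_integral_Gamma_exp_scaled:
  fixes r :: real
  assumes "Re z > 0" "r > 0"
  shows "has_bochner_integral lborel (\<lambda>x::real. exp (z * of_real x - of_real (r * exp x)))
           (Gamma z * of_real r powr (- z))"
proof -
  have "has_bochner_integral lborel
          (\<lambda>x::real. exp (z * of_real (ln r + 1 * x) - of_real (exp (ln r + 1 * x)))) (Gamma z)"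
    using has_bochner_integral_Gamma_exp [OF assms(1)]
    by (subst (asm) lborel_has_bochner_integral_real_affine_iff [of 1 _ _ "ln r"]) simp_all
  from has_bochner_integral_mult_left [of "of_real r powr (- z)", OF this]
  show ?thesis using assms
    by (auto simp: powr_def exp_minus exp_add ring_distribs exp_diff Ln_of_real field_simps)
qed

text \<open>
  The absolute value of the integrand of Euler's integral depends on \<open>Re z\<close> only.
\<close>

lemma norm_Gamma_le:
  assumes "Re z > 0"
  shows "norm (Gamma z) \<le> Gamma (Re z)"
proof -
  have "norm (Gamma z) = norm (\<integral>x. exp (z * of_real x - of_real (exp x)) \<partial>lborel)"
    using has_bochner_integral_Gamma_exp [OF assms] by (simp add: has_bochner_integral_iff)
  also have "\<dots> \<le> (\<integral>x. norm (exp (z * of_real x - of_real (exp x))) \<partial>lborel)"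
    by (rule integral_norm_bound)
  also have "\<dots> = Re (\<integral>x. exp (of_real (Re z) * of_real x - of_real (exp x)) \<partial>lborel)"
    using has_bochner_integral_Gamma_exp [of "of_real (Re z)"] assms
    by (subst integral_Re [symmetric])
       (auto simp: has_bochner_integral_iff Re_exp norm_exp_eq_Re)
  also have "\<dots> = Re (Gamma (of_real (Re z)))"
    using has_bochner_integral_Gamma_exp [of "of_real (Re z)"] assms by (simp add: has_bochner_integral_iff)
  finally show ?thesis by (simp add: Gamma_complex_of_real)
qed

lemma has_bochner_integral_Gamma_exp_scaled_real:
  fixes a r :: real
  assumes "a > 0" "r > 0"
  shows "has_bochner_integral lborel (\<lambda>x::real. exp (a * x - r * exp x)) (Gamma a * r powr (- a))"
proof (rule has_bochner_integral_of_realD)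
  show "has_bochner_integral lborel (\<lambda>x. complex_of_real (exp (a * x - r * exp x)))
          (of_real (Gamma a * r powr (- a)))"
    using has_bochner_integral_Gamma_exp_scaled [of "of_real a" r] assms
    by (simp add: Gamma_complex_of_real exp_of_real [symmetric] powr_of_real [symmetric])
qed

text \<open>
  The integrand decays quadratically: in
  \<open>\<Gamma>(z) = \<Gamma>(z + 2) / (z (z + 1))\<close> the numerator is bounded on a vertical line and the denominator
  grows quadratically.
\<close>

lemma integrable_Gamma_mult_Gamma:
  assumes "A > 0" "D > 0"
  shows "integrable lborel (\<lambda>t. Gamma (of_real A - \<i> * of_real t) * Gamma (of_real D + \<i> * of_real t))"
proof -
  define C where "C = Gamma (A + 2) * Gamma D / min 1 (A\<^sup>2)"
  show ?thesis
  proof (rule Bochner_Integration.integrable_bound)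
    show "integrable lborel (\<lambda>t::real. C * inverse (1 + t\<^sup>2))"
      using integrable_inverse_1_plus_square by (simp add: set_integrable_def)
    have "continuous_on UNIV (\<lambda>t. Gamma (of_real A - \<i> * of_real t) * Gamma (of_real D + \<i> * of_real t))"
      using assms complex_not_nonpos_Int
      by (intro continuous_intros continuous_on_compose2 [OF continuous_on_Gamma [of "{z. Re z > 0}"]]) auto
    then show "(\<lambda>t. Gamma (of_real A - \<i> * of_real t) * Gamma (of_real D + \<i> * of_real t))
            \<in> borel_measurable lborel"
      by (simp add: borel_measurable_continuous_onI)
    show "AE t in lborel. norm (Gamma (of_real A - \<i> * of_real t) * Gamma (of_real D + \<i> * of_real t))
            \<le> norm (C * inverse (1 + t\<^sup>2))"
    proof (rule AE_I2)
      fix t :: real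
      define z where "z = of_real A - \<i> * of_real t"
      have z: "Re z = A" "Im z = -t"
        by (simp_all add: z_def)
      have "Gamma (z + 2) = (z + 1) * Gamma (z + 1)"
        using Gamma_plus1 [of "z + 1"] complex_not_nonpos_Int [of "z + 1"] z assms by (simp add: add.assoc)
      also have "\<dots> = (z + 1) * z * Gamma z"
        using complex_not_nonpos_Int [of z] z assms by (simp add: Gamma_plus1)
      finally have shift: "norm (Gamma (z + 2)) = norm (z + 1) * norm z * norm (Gamma z)"
        by (simp add: norm_mult)
      have "min 1 (A\<^sup>2) * (1 + t\<^sup>2) \<le> A\<^sup>2 + t\<^sup>2"
      proof (cases "A\<^sup>2 \<le> 1")
        case True
        then show ?thesis using mult_right_mono [of "A\<^sup>2" 1 "t\<^sup>2"] by (simp add: algebra_simps)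
      qed auto
      also have "\<dots> = norm z * norm z"
        using z by (simp add: cmod_def flip: power2_eq_square)
      also have "\<dots> \<le> norm (z + 1) * norm z"
        using z assms by (intro mult_right_mono) (auto simp: cmod_def intro!: power_mono)
      finally have "min 1 (A\<^sup>2) * (1 + t\<^sup>2) * norm (Gamma z) \<le> norm (Gamma (z + 2))"
        unfolding shift by (rule mult_right_mono) simp
      also have "\<dots> \<le> Gamma (A + 2)"
        using norm_Gamma_le [of "z + 2"] z assms by simp
      finally have "norm (Gamma z) \<le> Gamma (A + 2) / min 1 (A\<^sup>2) * inverse (1 + t\<^sup>2)"
        using assms by (simp add: field_simps add_pos_nonneg)
      moreover have "norm (Gamma (of_real D + \<i> * of_real t)) \<le> Gamma D"
        using norm_Gamma_le [of "of_real D + \<i> * of_real t"] assms by simp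
      ultimately have "norm (Gamma z) * norm (Gamma (of_real D + \<i> * of_real t))
             \<le> Gamma (A + 2) / min 1 (A\<^sup>2) * inverse (1 + t\<^sup>2) * Gamma D"
        using assms by (intro mult_mono) auto
      then have "norm (Gamma (of_real A - \<i> * of_real t) * Gamma (of_real D + \<i> * of_real t))
            \<le> C * inverse (1 + t\<^sup>2)"
        unfolding z_def C_def by (simp add: norm_mult mult_ac)
      then show "norm (Gamma (of_real A - \<i> * of_real t) * Gamma (of_real D + \<i> * of_real t))
            \<le> norm (C * inverse (1 + t\<^sup>2))"
        by (rule order_trans) simp
    qed
  qed
qed

section \<open>Fourier inversion\<close>

lemma has_bochner_integral_std_normal_iexp:
  "has_bochner_integral lborel (\<lambda>x. std_normal_density x *\<^sub>R iexp (s * x)) (of_real (exp (- s\<^sup>2 / 2)))"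
proof -
  have "(CLBINT x. std_normal_density x *\<^sub>R iexp (s * x)) = char std_normal_distribution s"
    unfolding char_def by (subst integral_density) auto
  moreover have "integrable lborel (\<lambda>x. std_normal_density x *\<^sub>R iexp (s * x))"
    by (rule Bochner_Integration.integrable_bound [where f = "std_normal_density"]) auto
  ultimately show ?thesis
    by (simp add: has_bochner_integral_iff char_std_normal_distribution)
qed

text \<open>
  The Fourier transform of the Gaussian damping factor in the inversion theorem below: an approximate
  identity of width \<open>e\<close>, of total mass \<open>2 \<pi>\<close>.
\<close>

lemma has_bochner_integral_iexp_gaussian:
  assumes "e > 0"
  shows "has_bochner_integral lborel (\<lambda>t. iexp (t * w) * of_real (exp (- (e * t)\<^sup>2 / 2)))
           (of_real (2 * pi / e * std_normal_density (w / e)))"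
proof -
  have "has_bochner_integral lborel
         (\<lambda>t. std_normal_density (0 + e * t) *\<^sub>R iexp (w / e * (0 + e * t)))
         (of_real (exp (- (w / e)\<^sup>2 / 2)) /\<^sub>R \<bar>e\<bar>)"
    using has_bochner_integral_std_normal_iexp [of "w / e"] assms
    by (subst (asm) lborel_has_bochner_integral_real_affine_iff [of e _ _ 0]) simp_all
  from has_bochner_integral_scaleR_right [of "sqrt (2 * pi)", OF this]
  have "has_bochner_integral lborel
         (\<lambda>t. sqrt (2 * pi) *\<^sub>R (std_normal_density (0 + e * t) *\<^sub>R iexp (w / e * (0 + e * t))))
         (sqrt (2 * pi) *\<^sub>R (of_real (exp (- (w / e)\<^sup>2 / 2)) /\<^sub>R \<bar>e\<bar>))" .
  moreover have "sqrt (2 * pi) *\<^sub>R (std_normal_density (0 + e * t) *\<^sub>R iexp (w / e * (0 + e * t)))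
                   = iexp (t * w) * of_real (exp (- (e * t)\<^sup>2 / 2))" for t
    using assms by (simp add: std_normal_density_def scaleR_conv_of_real mult_ac)
  moreover have "sqrt (2 * pi) *\<^sub>R (complex_of_real (exp (- (w / e)\<^sup>2 / 2)) /\<^sub>R \<bar>e\<bar>)
                   = of_real (2 * pi / e * std_normal_density (w / e))"
  proof -
    have "2 * pi / e * (1 / s * X) = (2 * pi / s) * (X / e)" for X s
      by algebra
    then have eq: "2 * pi / e * std_normal_density (w / e) = sqrt (2 * pi) * (exp (- (w / e)\<^sup>2 / 2) / e)"
      unfolding std_normal_density_def using real_div_sqrt [of "2 * pi"]
      by (metis pi_ge_zero mult_nonneg_nonneg zero_le_numeral)
    have "sqrt (2 * pi) *\<^sub>R (complex_of_real X /\<^sub>R \<bar>e\<bar>) = of_real (sqrt (2 * pi) * (X / e))" for X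
      using assms by (simp add: scaleR_conv_of_real field_simps)
    then show ?thesis
      unfolding eq .
  qed
  ultimately show ?thesis
    by (simp only:)
qed

text \<open>
  Damp the outer integral by a Gaussian of width \<open>1/e\<close>. Fubini's theorem then applies and moves the
  transform onto the Gaussian, which leaves \<open>2 \<pi>\<close> times the average of \<open>f\<close> around \<open>x\<close> against a normal
  density of standard deviation \<open>e\<close>. Let \<open>e\<close> tend to 0 on both sides: the left side converges because
  the transform is integrable, the right side because \<open>f\<close> is bounded and continuous.
\<close>

theorem fourier_inversion:
  fixes f :: "real \<Rightarrow> complex"
  assumes cont: "continuous_on UNIV f" and bdd: "\<And>x. norm (f x) \<le> B"
    and int: "integrable lborel f"
    and int_hat: "integrable lborel (\<lambda>t. LBINT y. f y * iexp (- t * y))"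
  shows "(LBINT t. (LBINT y. f y * iexp (- t * y)) * iexp (t * x)) = 2 * pi * f x"
proof (rule LIMSEQ_unique)
  define F where "F = (\<lambda>t. LBINT y. f y * iexp (- t * y))"
  define e where "e = (\<lambda>n. inverse (real (Suc n)))"
  define g where "g = (\<lambda>n t. complex_of_real (exp (- (e n * t)\<^sup>2 / 2)))"
  have e_pos: "e n > 0" for n
    by (simp add: e_def)
  have e_lim: "e \<longlonglongrightarrow> 0"
    unfolding e_def by (rule LIMSEQ_inverse_real_of_nat)
  have [measurable]: "F \<in> borel_measurable borel" "f \<in> borel_measurable borel"
     using int_hat int unfolding F_def by auto
  have [measurable]: "g n \<in> borel_measurable borel" for n
    unfolding g_def by measurable
  have "(\<lambda>n. LBINT t. F t * iexp (t * x) * g n t) \<longlonglongrightarrow> (LBINT t. F t * iexp (t * x))"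
  proof (rule integral_dominated_convergence [where w = "\<lambda>t. norm (F t)"])
    show "AE t in lborel. (\<lambda>n. F t * iexp (t * x) * g n t) \<longlonglongrightarrow> F t * iexp (t * x)"
    proof (rule AE_I2)
      fix t
      have "(\<lambda>n. F t * iexp (t * x) * g n t) \<longlonglongrightarrow> F t * iexp (t * x) * of_real (exp (- (0 * t)\<^sup>2 / 2))"
        unfolding g_def by (intro tendsto_intros e_lim) simp_all
      then show "(\<lambda>n. F t * iexp (t * x) * g n t) \<longlonglongrightarrow> F t * iexp (t * x)" by simp
    qed
    show "integrable lborel (\<lambda>t. norm (F t))"
      using int_hat by (simp add: F_def)
    show "AE t in lborel. norm (F t * iexp (t * x) * g n t) \<le> norm (F t)" for n
      by (intro AE_I2) (auto simp: norm_mult g_def mult_left_le)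
  qed auto
  then show "(\<lambda>n. LBINT t. F t * iexp (t * x) * g n t) \<longlonglongrightarrow>
               (LBINT t. (LBINT y. f y * iexp (- t * y)) * iexp (t * x))"
    by (simp add: F_def)
  have eq: "(LBINT t. F t * iexp (t * x) * g n t) =
              2 * pi * (LBINT u. std_normal_density u *\<^sub>R f (x + e n * u))" for n
  proof -
    define k where "k = (\<lambda>t y. f y * (iexp (t * (x - y)) * g n t))"
    have g_int: "integrable lborel (g n)"
      using has_bochner_integral_iexp_gaussian [OF e_pos [of n], of 0]
      by (simp add: g_def has_bochner_integral_iff)
    have k_int: "integrable (lborel \<Otimes>\<^sub>M lborel) (case_prod k)"
    proof (rule lborel_pair.Fubini_integrable)
      show "case_prod k \<in> borel_measurable (lborel \<Otimes>\<^sub>M lborel)"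
        unfolding k_def by measurable
      show "integrable lborel (\<lambda>t. LBINT y. norm (case (t, y) of (t, y) \<Rightarrow> k t y))"
        using int g_int by (simp add: k_def norm_mult)
      show "AE t in lborel. integrable lborel (\<lambda>y. case (t, y) of (t, y) \<Rightarrow> k t y)"
      proof (rule AE_I2)
        fix t
        show "integrable lborel (\<lambda>y. case (t, y) of (t, y) \<Rightarrow> k t y)"
          by (rule Bochner_Integration.integrable_bound [OF int])
             (auto simp: k_def norm_mult g_def intro!: AE_I2 mult_left_le)
      qed
    qed
    have "(LBINT t. F t * iexp (t * x) * g n t) = (LBINT t. LBINT y. k t y)"
    proof (rule Bochner_Integration.integral_cong [OF refl])
      fix t
      have "F t * iexp (t * x) * g n t = (LBINT y. f y * iexp (- t * y) * (iexp (t * x) * g n t))"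
        unfolding F_def integral_mult_left_zero by (simp only: mult.assoc)
      also have "\<dots> = (LBINT y. k t y)"
        by (intro Bochner_Integration.integral_cong [OF refl])
           (simp add: k_def right_diff_distrib exp_diff exp_minus divide_inverse)
      finally show "F t * iexp (t * x) * g n t = (LBINT y. k t y)" .
    qed
    also have "\<dots> = (LBINT y. LBINT t. k t y)"
      using lborel_pair.Fubini_integral [OF k_int] by simp
    also have "\<dots> = (LBINT y. f y * of_real (2 * pi / e n * std_normal_density ((x - y) / e n)))"
      unfolding k_def g_def integral_mult_right_zero
        has_bochner_integral_integral_eq [OF has_bochner_integral_iexp_gaussian [OF e_pos [of n]]] ..
    \<comment> \<open>Rescaling \<open>y = x + e n * u\<close> makes the width of the Gaussian independent of \<open>n\<close>.\<close>
    also have "\<dots> = \<bar>e n\<bar> *\<^sub>R (LBINT u. f (x + e n * u) *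
                        of_real (2 * pi / e n * std_normal_density ((x - (x + e n * u)) / e n)))"
      using e_pos [of n] by (subst lborel_integral_real_affine [of "e n" _ x]) auto
    also have "\<dots> = (LBINT u. (2 * pi) * (std_normal_density u *\<^sub>R f (x + e n * u)))"
      using e_pos [of n] unfolding integral_scaleR_right [symmetric]
      by (intro Bochner_Integration.integral_cong [OF refl])
         (simp add: scaleR_conv_of_real std_normal_density_def)
    also have "\<dots> = 2 * pi * (LBINT u. std_normal_density u *\<^sub>R f (x + e n * u))"
      by (rule integral_mult_right_zero)
    finally show ?thesis .
  qed
  have "(\<lambda>n. LBINT u. std_normal_density u *\<^sub>R f (x + e n * u)) \<longlonglongrightarrow> (LBINT u. std_normal_density u *\<^sub>R f x)"
  proof (rule integral_dominated_convergence [where w = "\<lambda>u. B * std_normal_density u"])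
    show "AE u in lborel. (\<lambda>n. std_normal_density u *\<^sub>R f (x + e n * u)) \<longlonglongrightarrow> std_normal_density u *\<^sub>R f x"
    proof (rule AE_I2)
      fix u
      have "(\<lambda>n. x + e n * u) \<longlonglongrightarrow> x + 0 * u"
        by (intro tendsto_intros e_lim)
      then have "(\<lambda>n. f (x + e n * u)) \<longlonglongrightarrow> f x"
        using cont by (intro isCont_tendsto_compose [of x f]) (auto simp: continuous_on_eq_continuous_at)
      then show "(\<lambda>n. std_normal_density u *\<^sub>R f (x + e n * u)) \<longlonglongrightarrow> std_normal_density u *\<^sub>R f x"
        by (intro tendsto_intros)
    qed
    show "AE u in lborel. norm (std_normal_density u *\<^sub>R f (x + e n * u)) \<le> B * std_normal_density u" for n
      using bdd by (intro AE_I2) (simp add: mult.commute [of B] mult_left_mono)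
  qed auto
  moreover have "(LBINT u. std_normal_density u *\<^sub>R f x) = f x"
    by simp
  ultimately show "(\<lambda>n. LBINT t. F t * iexp (t * x) * g n t) \<longlonglongrightarrow> 2 * pi * f x"
    unfolding eq by (intro tendsto_intros) simp
qed

section \<open>The Beta integral and Barnes' first lemma\<close>

lemma integrable_pair_mult:
  fixes f g :: "real \<Rightarrow> complex"
  assumes "integrable lborel f" "integrable lborel g"
  shows "integrable (lborel \<Otimes>\<^sub>M lborel) (\<lambda>(x, y). f x * g y)"
proof (rule lborel_pair.Fubini_integrable)
  have [measurable]: "f \<in> borel_measurable borel" "g \<in> borel_measurable borel"
    using assms by auto
  show "(\<lambda>(x, y). f x * g y) \<in> borel_measurable (lborel \<Otimes>\<^sub>M lborel)"
    by measurable
  show "integrable lborel (\<lambda>x. LBINT y. norm (case (x, y) of (x, y) \<Rightarrow> f x * g y))"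
    using assms by (simp add: norm_mult)
  show "AE x in lborel. integrable lborel (\<lambda>y. case (x, y) of (x, y) \<Rightarrow> f x * g y)"
    using assms by simp
qed

lemma integrable_pair_mult_bounded:
  fixes f g :: "real \<Rightarrow> complex" and h :: "real \<Rightarrow> real \<Rightarrow> complex"
  assumes "integrable lborel f" "integrable lborel g"
    and "case_prod h \<in> borel_measurable (borel \<Otimes>\<^sub>M borel)" and "\<And>x y. norm (h x y) \<le> 1"
  shows "integrable (lborel \<Otimes>\<^sub>M lborel) (\<lambda>(x, y). f x * g y * h x y)"
proof (rule Bochner_Integration.integrable_bound [OF integrable_pair_mult [OF assms(1,2)]])
  have [measurable]: "f \<in> borel_measurable borel" "g \<in> borel_measurable borel"
    using assms by auto
  note assms(3) [measurable]
  show "(\<lambda>(x, y). f x * g y * h x y) \<in> borel_measurable (lborel \<Otimes>\<^sub>M lborel)"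
    by measurable
  show "AE p in lborel \<Otimes>\<^sub>M lborel. norm (case p of (x, y) \<Rightarrow> f x * g y * h x y)
          \<le> norm (case p of (x, y) \<Rightarrow> f x * g y)"
    using assms(4) by (auto simp: norm_mult mult_left_le)
qed

text \<open>
  Euler's Beta integral in logistic form. The product \<open>\<Gamma>(u) \<Gamma>(v)\<close> is a double integral of
  \<open>exp(u x' + v y - exp x' - exp y)\<close>; the shift \<open>x' = x + y\<close> gives the kernel \<open>h\<close> of the proof, whose
  integral over \<open>y\<close> is again a Gamma integral, with scale \<open>1 + exp x\<close>.
\<close>

lemma has_bochner_integral_Beta_exp:
  fixes u v :: complex and \<sigma> :: real
  assumes u: "Re u > 0" and v: "Re v > 0" and uv: "u + v = of_real \<sigma>"
  shows "has_bochner_integral lborel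
           (\<lambda>x. exp (u * of_real x) * of_real ((1 + exp x) powr (- \<sigma>)))
           (Gamma u * Gamma v / of_real (Gamma \<sigma>))"
proof -
  define h where
    "h = (\<lambda>y x::real. exp (u * of_real x + of_real (\<sigma> * y) - of_real ((1 + exp x) * exp y)))"
  have Re_uv: "Re u + Re v = \<sigma>" and "\<sigma> > 0"
    using arg_cong [OF uv, of Re] u v by simp_all
  have h_x: "has_bochner_integral lborel (h y) (Gamma u * exp (v * of_real y - of_real (exp y)))" for y
  proof -
    have "of_real (exp y) powr (- u) = exp (- u * of_real y)"
      by (simp add: powr_def Ln_of_real)
    with has_bochner_integral_mult_right
           [of "exp (of_real (\<sigma> * y) - of_real (exp y))", OF
             has_bochner_integral_Gamma_exp_scaled [OF u, of "exp y"]]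
    show ?thesis
      by (simp add: h_def uv [symmetric] algebra_simps flip: exp_add exp_diff)
  qed
  have norm_h_x: "has_bochner_integral lborel (\<lambda>x. norm (h y x))
                    (Gamma (Re u) * exp (Re v * y - exp y))" for y
  proof -
    have "exp y powr (- Re u) = exp (- Re u * y)"
      by (simp add: powr_def)
    with has_bochner_integral_mult_right
           [of "exp (\<sigma> * y - exp y)", OF
             has_bochner_integral_Gamma_exp_scaled_real [OF u, of "exp y"]]
    show ?thesis
      by (simp add: h_def Re_uv [symmetric] algebra_simps flip: exp_add exp_diff)
  qed
  have h_y: "(LBINT y. h y x) = of_real (Gamma \<sigma>) * (exp (u * of_real x) * of_real ((1 + exp x) powr (- \<sigma>)))" for x
  proof -
    have "1 + exp x > 0"
      by (simp add: add_pos_pos)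
    with has_bochner_integral_mult_right
           [of "exp (u * of_real x)", OF
             has_bochner_integral_Gamma_exp_scaled [of "of_real \<sigma>" "1 + exp x"]] \<open>\<sigma> > 0\<close>
    have "has_bochner_integral lborel (\<lambda>y. h y x) (exp (u * of_real x) * 
             (Gamma (of_real \<sigma>) * of_real (1 + exp x) powr (- of_real \<sigma>)))"
      by (simp add: h_def algebra_simps flip: exp_add exp_diff)
    then show ?thesis using \<open>1 + exp x > 0\<close>
      by (simp add: has_bochner_integral_iff Gamma_complex_of_real powr_of_real [symmetric])
  qed
  have meas: "case_prod h \<in> borel_measurable (lborel \<Otimes>\<^sub>M lborel)"
    unfolding h_def by measurable
  have "integrable lborel (\<lambda>y. LBINT x. norm (h y x))"
    using norm_h_x has_bochner_integral_Gamma_exp_scaled_real [OF v, of 1]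
    by (simp add: has_bochner_integral_iff)
  then have int: "integrable (lborel \<Otimes>\<^sub>M lborel) (case_prod h)"
    using h_x meas by (intro lborel_pair.Fubini_integrable) (auto simp: has_bochner_integral_iff)
  have int_x: "integrable lborel (\<lambda>x. LBINT y. h y x)"
    using lborel_pair.integrable_snd [OF int] .
  have "(LBINT x. LBINT y. h y x) = (LBINT y. LBINT x. h y x)"
    using lborel_pair.Fubini_integral [OF int] .
  also have "\<dots> = (LBINT y. Gamma u * exp (v * of_real y - of_real (exp y)))"
    using h_x by (simp add: has_bochner_integral_iff)
  also have "\<dots> = Gamma u * Gamma v"
    using has_bochner_integral_Gamma_exp [OF v] by (simp add: has_bochner_integral_iff)
  finally have "has_bochner_integral lborel
      (\<lambda>x. of_real (Gamma \<sigma>) * (exp (u * of_real x) * of_real ((1 + exp x) powr (- \<sigma>))))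
      (Gamma u * Gamma v)"
    using int_x unfolding h_y by (simp add: has_bochner_integral_iff)
  moreover have "Gamma \<sigma> \<noteq> 0"
    using \<open>\<sigma> > 0\<close> by (rule Gamma_real_nonzero)
  ultimately have "has_bochner_integral lborel
      (\<lambda>x. of_real (Gamma \<sigma>) * (exp (u * of_real x) * of_real ((1 + exp x) powr (- \<sigma>))) / of_real (Gamma \<sigma>))
      (Gamma u * Gamma v / of_real (Gamma \<sigma>))"
    by (intro has_bochner_integral_divide)
  then show ?thesis
    using \<open>Gamma \<sigma> \<noteq> 0\<close> by simp
qed

text \<open>
  The previous lemma at \<open>u = A - it\<close>, \<open>v = D + it\<close> reads as a Fourier transform in \<open>x\<close>; this is its
  inversion.
\<close>

lemma has_bochner_integral_Gamma_iexp:
  assumes A: "A > 0" and D: "D > 0"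
  shows "has_bochner_integral lborel
           (\<lambda>t. Gamma (of_real A - \<i> * of_real t) * Gamma (of_real D + \<i> * of_real t) * iexp (t * x))
           (of_real (2 * pi * Gamma (A + D) * exp (A * x) * (1 + exp x) powr (- (A + D))))"
proof -
  define f where "f = (\<lambda>y. complex_of_real (exp (A * y) * (1 + exp y) powr (- (A + D))))"
  define G where "G = (\<lambda>t. Gamma (of_real A - \<i> * of_real t) * Gamma (of_real D + \<i> * of_real t))"
  have AD: "Gamma (A + D) \<noteq> 0"
    using A D by (simp add: Gamma_real_nonzero)
  have one_plus_exp_pos: "1 + exp y > (0::real)" for y
    by (simp add: add_pos_pos)
  have f_hat: "(LBINT y. f y * iexp (- t * y)) = G t / of_real (Gamma (A + D))" for t
  proof -
    have "f y * iexp (- t * y) = exp ((of_real A - \<i> * of_real t) * of_real y)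
            * of_real ((1 + exp y) powr (- (A + D)))" for y
      by (simp add: f_def exp_of_real [symmetric] algebra_simps exp_diff exp_minus divide_inverse)
    then show ?thesis
      using has_bochner_integral_Beta_exp
        [of "of_real A - \<i> * of_real t" "of_real D + \<i> * of_real t" "A + D"] A D
      by (simp add: has_bochner_integral_iff G_def)
  qed
  have G_int: "integrable lborel G"
    unfolding G_def by (rule integrable_Gamma_mult_Gamma [OF A D])
  have "(LBINT t. (LBINT y. f y * iexp (- t * y)) * iexp (t * x)) = 2 * pi * f x"
  proof (rule fourier_inversion)
    show "continuous_on UNIV f"
      unfolding f_def using one_plus_exp_pos by (intro continuous_intros) (auto simp: less_imp_neq [symmetric])
    show "norm (f y) \<le> 1" for y
    proof -
      have "exp (A * y) = exp y powr A"
        by (simp add: powr_def mult.commute)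
      also have "\<dots> \<le> (1 + exp y) powr A"
        using A by (intro powr_mono2) auto
      also have "\<dots> \<le> (1 + exp y) powr (A + D)"
        using D by (intro powr_mono) auto
      finally have "exp (A * y) \<le> (1 + exp y) powr (A + D)" .
      moreover have "norm (f y) = exp (A * y) / (1 + exp y) powr (A + D)"
        unfolding f_def powr_minus_divide by (simp add: norm_mult norm_divide)
      ultimately show ?thesis
        using one_plus_exp_pos [of y] by simp
    qed
    show "integrable lborel f"
      unfolding f_def using has_bochner_integral_Beta_exp [of "of_real A" "of_real D" "A + D"] A D
      by (simp add: has_bochner_integral_iff exp_of_real [symmetric])
    show "integrable lborel (\<lambda>t. LBINT y. f y * iexp (- t * y))"
      unfolding f_hat using G_int by simp
  qed
  then have "(LBINT t. G t * iexp (t * x)) = Gamma (A + D) * (2 * pi * f x)"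
    unfolding f_hat using AD by (simp add: field_simps)
  moreover have "integrable lborel (\<lambda>t. G t * iexp (t * x))"
    by (rule Bochner_Integration.integrable_bound [OF G_int])
       (use G_int in \<open>auto simp: norm_mult\<close>)
  ultimately show ?thesis
    by (simp add: has_bochner_integral_iff G_def f_def mult_ac)
qed

text \<open>
  Parseval's formula for two logistic Fourier pairs: replace \<open>\<Gamma>(B - it) \<Gamma>(E + it)\<close> by the Fourier
  integral that it is, exchange the integrals, and invert the transform of the other two factors. What
  remains is a single logistic Beta integral.
\<close>

theorem Barnes_first_lemma:
  assumes A: "A > 0" and B: "B > 0" and D: "D > 0" and E: "E > 0"
  shows "has_bochner_integral lborel
           (\<lambda>t. Gamma (of_real A - \<i> * of_real t) * Gamma (of_real D + \<i> * of_real t)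
              * (Gamma (of_real B - \<i> * of_real t) * Gamma (of_real E + \<i> * of_real t)))
           (of_real (2 * pi * Gamma (A + D) * Gamma (A + E) * Gamma (B + D) * Gamma (B + E)
              / Gamma (A + B + D + E)))"
proof -
  define G where "G = (\<lambda>t. Gamma (of_real A - \<i> * of_real t) * Gamma (of_real D + \<i> * of_real t))"
  define G' where "G' = (\<lambda>t. Gamma (of_real B - \<i> * of_real t) * Gamma (of_real E + \<i> * of_real t))"
  define f where "f = (\<lambda>y. complex_of_real (exp (B * y) * (1 + exp y) powr (- (B + E))))"
  have BE: "Gamma (B + E) \<noteq> 0"
    using B E by (simp add: Gamma_real_nonzero)
  have one_plus_exp_pos: "1 + exp y > (0::real)" for y
    by (simp add: add_pos_pos)
  have G_int: "integrable lborel G"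
    unfolding G_def by (rule integrable_Gamma_mult_Gamma [OF A D])
  have f_int: "integrable lborel f"
    unfolding f_def using has_bochner_integral_Beta_exp [of "of_real B" "of_real E" "B + E"] B E
    by (simp add: has_bochner_integral_iff exp_of_real [symmetric])
  have f_hat: "(LBINT y. f y * iexp (- t * y)) = G' t / of_real (Gamma (B + E))" for t
  proof -
    have "f y * iexp (- t * y) = exp ((of_real B - \<i> * of_real t) * of_real y)
            * of_real ((1 + exp y) powr (- (B + E)))" for y
      by (simp add: f_def exp_of_real [symmetric] algebra_simps exp_diff exp_minus divide_inverse)
    then show ?thesis
      using has_bochner_integral_Beta_exp
        [of "of_real B - \<i> * of_real t" "of_real E + \<i> * of_real t" "B + E"] B E
      by (simp add: has_bochner_integral_iff G'_def)
  qed
  define k where "k = (\<lambda>t y. G t * f y * iexp (- t * y))"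
  have k_int: "integrable (lborel \<Otimes>\<^sub>M lborel) (case_prod k)"
    unfolding k_def by (rule integrable_pair_mult_bounded [OF G_int f_int]) simp_all
  have k_t: "(LBINT y. k t y) = G t * G' t / Gamma (B + E)" for t
    using f_hat [of t] by (simp add: k_def mult.assoc)
  \<comment> \<open>The inverse transform is taken at \<open>- y\<close>; the logistic function is symmetric up to exchanging \<open>A\<close> and \<open>D\<close>.\<close>
  have k_y: "(LBINT t. k t y) = of_real (2 * pi * Gamma (A + D)) *
               (exp (of_real (B + D) * of_real y) * of_real ((1 + exp y) powr (- (A + B + D + E))))" for y
  proof -
    have "(LBINT t. k t y) = f y * (LBINT t. G t * iexp (t * (- y)))"
      by (simp add: k_def mult_ac flip: integral_mult_right_zero)
    also have "\<dots> = f y * of_real (2 * pi * Gamma (A + D) * exp (A * (- y)) * (1 + exp (- y)) powr (- (A + D)))"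
      unfolding G_def has_bochner_integral_integral_eq [OF has_bochner_integral_Gamma_iexp [OF A D]] ..
    also have "\<dots> = of_real (2 * pi * Gamma (A + D) *
                       (exp ((B + D) * y) * (1 + exp y) powr (- (A + B + D + E))))"
    proof -
      have "1 + exp (- y) = exp (- y) * (1 + exp y)"
        by (simp add: ring_distribs flip: exp_add)
      then have "(1 + exp (- y)) powr (- (A + D)) = exp ((A + D) * y) * (1 + exp y) powr (- (A + D))"
        using one_plus_exp_pos [of y] by (simp add: powr_mult) (simp add: powr_def algebra_simps)
      then have flip: "exp (A * (- y)) * (1 + exp (- y)) powr (- (A + D)) = exp (D * y) * (1 + exp y) powr (- (A + D))"
        by (simp add: algebra_simps flip: exp_add)
      have "exp (B * y) * (1 + exp y) powr (- (B + E)) * (exp (D * y) * (1 + exp y) powr (- (A + D)))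
              = exp ((B + D) * y) * (1 + exp y) powr (- (A + B + D + E))"
        using powr_add [of "1 + exp y" "- (B + E)" "- (A + D)"]
          exp_add [of "B * y" "D * y"] by (simp add: algebra_simps)
      with flip show ?thesis
        unfolding f_def of_real_mult [symmetric] by (simp add: mult_ac)
    qed
    finally show ?thesis
      by (simp flip: exp_of_real)
  qed
  have "(LBINT t. G t * G' t / Gamma (B + E)) = (LBINT y. LBINT t. k t y)"
    unfolding k_t [symmetric] using lborel_pair.Fubini_integral [OF k_int] by simp
  also have "\<dots> = of_real (2 * pi * Gamma (A + D) * (Gamma (B + D) * Gamma (A + E) / Gamma (A + B + D + E)))"
    using has_bochner_integral_Beta_exp [of "of_real (B + D)" "of_real (A + E)" "A + B + D + E"] A B D E
    unfolding k_y integral_mult_right_zero has_bochner_integral_iff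
    by (simp add: Gamma_complex_of_real flip: of_real_add)
  finally have "(LBINT t. G t * G' t) = of_real (2 * pi * Gamma (A + D) * Gamma (A + E) * Gamma (B + D) * Gamma (B + E)
              / Gamma (A + B + D + E))"
    using BE by (simp add: field_simps)
  moreover have "integrable lborel (\<lambda>t. G t * G' t)"
  proof -
    have "integrable lborel (\<lambda>t. LBINT y. k t y)"
      using lborel_pair.integrable_fst [OF k_int] .
    then have "integrable lborel (\<lambda>t. Gamma (B + E) * (G t * G' t / Gamma (B + E)))"
      unfolding k_t by (intro integrable_mult_right)
    then show ?thesis
      using BE by simp
  qed
  ultimately show ?thesis
    by (simp add: has_bochner_integral_iff G_def G'_def)
qed

section \<open>Newton expansion and the Konhauser biorthogonality\<close>

lemma pochhammer_minus_over_fact: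
  fixes a :: "'a::field_char_0"
  shows "pochhammer (- a) n / fact n = (-1) ^ n * (a gchoose n)"
  by (simp add: gbinomial_pochhammer)

text \<open>
  Binomial inversion: the matrices \<open>(-1)^n (N choose n)\<close> and \<open>n choose i\<close> are inverse to each other up
  to sign.
\<close>

lemma sum_alternating_choose_mult_choose:
  "(\<Sum>n=0..N. (-1) ^ n * of_nat (N choose n) * of_nat (n choose i))
     = (if N = i then (-1) ^ N else 0 :: 'a::{idom,ring_char_0})"
proof (cases "i \<le> N")
  case True
  have "(\<Sum>n=0..N. (-1) ^ n * of_nat (N choose n) * of_nat (n choose i) :: 'a)
          = (\<Sum>n=i..N. (-1) ^ n * of_nat (N choose n) * of_nat (n choose i))"
    by (rule sum.mono_neutral_right) auto
  also have "\<dots> = (\<Sum>n\<le>N - i. (-1) ^ (n + i) * of_nat ((N choose (n + i)) * ((n + i) choose i)))"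
    using True by (intro sum.reindex_bij_witness [of _ "\<lambda>n. n + i" "\<lambda>n. n - i"]) auto
  also have "\<dots> = (\<Sum>n\<le>N - i. (-1) ^ i * of_nat (N choose i) * ((-1) ^ n * of_nat ((N - i) choose n)))"
    using True by (intro sum.cong refl) (subst choose_mult, auto simp: power_add)
  also have "\<dots> = (-1) ^ i * of_nat (N choose i) * (\<Sum>n\<le>N - i. (-1) ^ n * of_nat ((N - i) choose n))"
    by (rule sum_distrib_left [symmetric])
  also have "\<dots> = (if N = i then (-1) ^ N else 0)"
    using choose_alternating_sum [of "N - i", where 'a = 'a] True by auto
  finally show ?thesis .
qed (auto intro!: sum.neutral)

text \<open>
  Newton's forward difference formula. The inner sum is \<open>(-1)^r\<close> times the \<open>r\<close>-th forward difference of
  \<open>g\<close> at 0, that is, the coefficient of \<open>x gchoose r\<close> in \<open>g\<close>, and \<open>pochhammer X r / fact r\<close> is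
  \<open>(-1)^r (-X gchoose r)\<close>. Assuming the expansion of \<open>g\<close> expresses that \<open>g\<close> is a polynomial of degree at
  most \<open>j\<close>, which makes the truncated formula exact.
\<close>

lemma newton_expansion:
  fixes g :: "'a::field_char_0 \<Rightarrow> 'a"
  assumes g: "\<And>x. g x = (\<Sum>i=0..j. c i * (x gchoose i))"
  shows "(\<Sum>r=0..j. pochhammer X r / fact r
            * (\<Sum>n=0..r. pochhammer (- of_nat r) n / fact n * g (of_nat n))) = g (- X)"
proof -
  have inner: "(\<Sum>n=0..r. pochhammer (- of_nat r) n / fact n * g (of_nat n)) = (-1) ^ r * c r"
    if "r \<le> j" for r
  proof -
    have "(\<Sum>n=0..r. pochhammer (- of_nat r) n / fact n * g (of_nat n))
            = (\<Sum>n=0..r. \<Sum>i=0..j. c i * ((-1) ^ n * of_nat (r choose n) * of_nat (n choose i)))"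
      unfolding g pochhammer_minus_over_fact sum_distrib_left
      by (intro sum.cong refl) (simp add: binomial_gbinomial mult_ac)
    also have "\<dots> = (\<Sum>i=0..j. c i * (if r = i then (-1) ^ r else 0))"
      unfolding sum_alternating_choose_mult_choose [symmetric] sum_distrib_left
      by (rule sum.swap)
    also have "\<dots> = (\<Sum>i=0..j. if r = i then c i * (-1) ^ r else 0)"
      by (intro sum.cong) auto
    finally show ?thesis
      using that by simp
  qed
  have "pochhammer X r / fact r = (-1) ^ r * ((- X) gchoose r)" for r
    using pochhammer_minus_over_fact [of "- X" r] by simp
  then have "(\<Sum>r=0..j. pochhammer X r / fact r
            * (\<Sum>n=0..r. pochhammer (- of_nat r) n / fact n * g (of_nat n)))
         = (\<Sum>r=0..j. c r * ((- X) gchoose r))"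
    by (intro sum.cong refl, simp only: inner atLeastAtMost_iff) (simp add: mult_ac)
  then show ?thesis
    by (simp add: g)
qed

text \<open>
  Each further factor of the Pochhammer symbol is linear in \<open>x\<close>, and multiplication by \<open>x\<close> acts on the
  basis by \<open>x (x gchoose i) = (i + 1) (x gchoose (i + 1)) + i (x gchoose i)\<close>.
\<close>

lemma pochhammer_linear_gchoose_expansion:
  fixes \<alpha> \<gamma> :: "'a::field_char_0"
  shows "\<exists>c. \<forall>x. pochhammer (\<alpha> * x + \<gamma>) j = (\<Sum>i=0..j. c i * (x gchoose i))"
proof (induction j)
  case 0
  show ?case by (intro exI [of _ "\<lambda>_. 1"]) simp
next
  case (Suc j)
  then obtain c where c: "\<And>x. pochhammer (\<alpha> * x + \<gamma>) j = (\<Sum>i=0..j. c i * (x gchoose i))"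
    by blast
  \<comment> \<open>The first summand collects the shifted terms; the guard at \<open>Suc j\<close> cuts off a coefficient that \<open>c\<close> leaves unspecified.\<close>
  define c' where "c' = (\<lambda>i. (if i = 0 then 0 else \<alpha> * of_nat i * c (i - 1))
                          + (if i = Suc j then 0 else (\<alpha> * of_nat i + \<gamma> + of_nat j) * c i))"
  have step: "x * (x gchoose i) = of_nat (Suc i) * (x gchoose Suc i) + of_nat i * (x gchoose i)" for x :: 'a and i
    using gbinomial_mult_1 [of x i] by (simp add: add.commute)
  have "pochhammer (\<alpha> * x + \<gamma>) (Suc j) = (\<Sum>i=0..Suc j. c' i * (x gchoose i))" for x
  proof -
    have "pochhammer (\<alpha> * x + \<gamma>) (Suc j)
            = (\<Sum>i=0..j. c i * (\<alpha> * (x * (x gchoose i)) + (\<gamma> + of_nat j) * (x gchoose i)))"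
      unfolding pochhammer_Suc c sum_distrib_right by (intro sum.cong refl) algebra
    also have "\<dots> = (\<Sum>i=0..j. \<alpha> * of_nat (Suc i) * c i * (x gchoose Suc i))
                  + (\<Sum>i=0..j. (\<alpha> * of_nat i + \<gamma> + of_nat j) * c i * (x gchoose i))"
      unfolding step sum.distrib [symmetric] by (intro sum.cong refl) algebra
    also have "(\<Sum>i=0..j. \<alpha> * of_nat (Suc i) * c i * (x gchoose Suc i))
                 = (\<Sum>i=0..Suc j. (if i = 0 then 0 else \<alpha> * of_nat i * c (i - 1)) * (x gchoose i))"
      by (subst sum.atLeast0_atMost_Suc_shift) simp
    also have "(\<Sum>i=0..j. (\<alpha> * of_nat i + \<gamma> + of_nat j) * c i * (x gchoose i))
                 = (\<Sum>i=0..Suc j. (if i = Suc j then 0 else (\<alpha> * of_nat i + \<gamma> + of_nat j) * c i) * (x gchoose i))"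
      by simp
    finally show ?thesis
      unfolding c'_def distrib_right sum.distrib .
  qed
  then show ?case by blast
qed

lemma newton_expansion_pochhammer:
  fixes A X v :: "'a::field_char_0"
  shows "(\<Sum>r=0..j. pochhammer X r / fact r
            * (\<Sum>n=0..r. pochhammer (- of_nat r) n / fact n * pochhammer ((A + of_nat n) / v) j))
         = pochhammer ((A - X) / v) j"
proof -
  obtain c where "\<And>x. pochhammer (1 / v * x + A / v) j = (\<Sum>i=0..j. c i * (x gchoose i))"
    using pochhammer_linear_gchoose_expansion by blast
  from newton_expansion [OF this] show ?thesis
    by (simp add: add_divide_distrib diff_divide_distrib add.commute)
qed

text \<open>
  Newton's formula collapses the two inner sums to \<open>(-n)_j / j! = (-1)^j (n choose j)\<close>, and binomial
  inversion in \<open>n\<close> leaves 1 for \<open>j = N\<close> and 0 for all other \<open>j\<close>. For fixed \<open>j\<close> this is the biorthogonality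
  of the Konhauser polynomials; the sum over \<open>j \<le> s\<close> merely records whether \<open>N\<close> is reached.
\<close>

lemma sum_konhauser_biorthogonality:
  fixes A v :: "'a::field_char_0"
  assumes "v \<noteq> 0"
  shows "(\<Sum>n=0..N. pochhammer (- of_nat N) n / fact n
            * (\<Sum>j=0..s. (\<Sum>r=0..j. pochhammer (A + v * of_nat n) r / fact r
                 * (\<Sum>m=0..r. pochhammer (- of_nat r) m / fact m * pochhammer ((A + of_nat m) / v) j)) / fact j))
         = (if N \<le> s then 1 else 0)"
proof -
  have "(A - (A + v * of_nat n)) / v = - of_nat n" for n
    using assms by simp
  then have "(\<Sum>n=0..N. pochhammer (- of_nat N) n / fact n
            * (\<Sum>j=0..s. (\<Sum>r=0..j. pochhammer (A + v * of_nat n) r / fact r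
                 * (\<Sum>m=0..r. pochhammer (- of_nat r) m / fact m * pochhammer ((A + of_nat m) / v) j)) / fact j))
      = (\<Sum>n=0..N. \<Sum>j=0..s. (-1) ^ j * ((-1) ^ n * of_nat (N choose n) * of_nat (n choose j)))"
    unfolding newton_expansion_pochhammer
    by (simp add: pochhammer_minus_over_fact sum_distrib_left binomial_gbinomial mult_ac)
  also have "\<dots> = (\<Sum>j=0..s. (-1) ^ j * (if N = j then (-1) ^ N else 0))"
    unfolding sum_alternating_choose_mult_choose [symmetric] sum_distrib_left by (rule sum.swap)
  also have "\<dots> = (\<Sum>j=0..s. if N = j then 1 else 0)"
    by (intro sum.cong) (auto simp flip: power_add mult_2)
  finally show ?thesis
    by simp
qed

section \<open>The Pfaff-Saalschuetz summation\<close>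

lemma sum_Suc_choose:
  fixes h :: "nat \<Rightarrow> 'a::comm_semiring_1"
  shows "(\<Sum>m\<le>Suc n. of_nat (Suc n choose m) * h m) = (\<Sum>m\<le>n. of_nat (n choose m) * (h m + h (Suc m)))"
proof -
  have "(\<Sum>m\<le>Suc n. of_nat (n choose m) * h m) = (\<Sum>m\<le>n. of_nat (n choose m) * h m)"
    by (simp add: binomial_eq_0)
  moreover have "(\<Sum>m\<le>Suc n. of_nat (Suc n choose m) * h m)
          = h 0 + (\<Sum>m\<le>n. of_nat (n choose Suc m) * h (Suc m)) + (\<Sum>m\<le>n. of_nat (n choose m) * h (Suc m))"
    by (subst sum.atMost_Suc_shift) (simp add: sum.distrib algebra_simps)
  moreover have "(\<Sum>m\<le>Suc n. of_nat (n choose m) * h m) = h 0 + (\<Sum>m\<le>n. of_nat (n choose Suc m) * h (Suc m))"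
    by (subst sum.atMost_Suc_shift) simp
  ultimately show ?thesis
    by (simp add: sum.distrib distrib_left)
qed

text \<open>
  The balanced terminating hypergeometric sum \<open>3F2(-n, A, B; C, 1 + A + B - C - n; 1)\<close>, multiplied by
  \<open>(C)_n (E)_n\<close> with \<open>E = C - A - B\<close>, so that both sides are polynomials in the
  parameters. The proof is by induction on \<open>n\<close>: the sum \<open>s(n)\<close> satisfies
  \<open>s(n + 1) = (C - A + n) (C - B + n) s(n)\<close>, because the difference of the two sides telescopes.
\<close>

theorem Pfaff_Saalschuetz:
  fixes A B E :: "'a::field_char_0"
  defines "C \<equiv> A + B + E"
  shows "(\<Sum>m\<le>n. of_nat (n choose m) * (pochhammer A m * pochhammer B m
             * pochhammer E (n - m) * pochhammer (C + of_nat m) (n - m)))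
         = pochhammer (C - A) n * pochhammer (C - B) n"
proof (induction n)
  case (Suc n)
  define F where "F = (\<lambda>m. of_nat (n choose m) * (pochhammer A m * pochhammer B m
             * pochhammer E (n - m) * pochhammer (C + of_nat m) (n - m)))"
  define H where "H = (\<lambda>m. pochhammer A m * pochhammer B m
             * pochhammer E (Suc n - m) * pochhammer (C + of_nat m) (Suc n - m))"
  \<comment> \<open>The telescoping certificate: \<open>G\<close> vanishes at \<open>0\<close> and at \<open>Suc n\<close>.\<close>
  define G where "G = (\<lambda>m. of_nat (m * (n choose m)) * (pochhammer A m * pochhammer B m
             * pochhammer E (Suc n - m) * pochhammer (C + of_nat m) (n - m)))"
  have step: "of_nat (n choose m) * (H m + H (Suc m))
      = (C - A + of_nat n) * (C - B + of_nat n) * F m + (G (Suc m) - G m)" if "m \<le> n" for m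
  proof -
    have absorb: "of_nat (Suc m * (n choose Suc m)) = of_nat (n choose m) * (of_nat (n - m) :: 'a)"
      by (metis of_nat_mult mult.commute binomial_absorb_comp binomial_absorption)
    show ?thesis
    proof (cases "n = m")
      case True
      then show ?thesis
        by (simp add: F_def G_def H_def pochhammer_Suc C_def binomial_eq_0 algebra_simps)
    next
      case False
      with that obtain q where n: "n = m + Suc q"
        by (metis less_imp_Suc_add le_neq_implies_less add_Suc_right)
      \<comment> \<open>Only for \<open>n - m > 0\<close> can the factor \<open>C + of_nat m\<close> be split off the last Pochhammer symbol.\<close>
      define a b e y ch where "a = pochhammer A m" and "b = pochhammer B m"
        and "e = pochhammer E (Suc q)" and "y = pochhammer (C + of_nat m + 1) q"
        and "ch = (of_nat (n choose m) :: 'a)"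
      have diffs: "Suc n - m = Suc (Suc q)" "n - m = Suc q" "Suc n - Suc m = Suc q" "n - Suc m = q"
        by (simp_all add: n)
      have pE: "pochhammer E (Suc (Suc q)) = e * (E + of_nat (Suc q))"
        by (simp add: e_def pochhammer_Suc [of E "Suc q"])
      have y': "pochhammer (C + of_nat (Suc m)) q = y"
        by (simp add: y_def add_ac)
      have y'': "pochhammer (C + of_nat (Suc m)) (Suc q) = y * (C + of_nat n)"
        unfolding pochhammer_Suc y' by (simp add: n add_ac)
      have y1: "pochhammer (C + of_nat m) (Suc k) = (C + of_nat m) * pochhammer (C + of_nat (Suc m)) k" for k
        unfolding pochhammer_rec by (simp add: add_ac)
      have "H m = a * b * (e * (E + of_nat (Suc q))) * ((C + of_nat m) * (y * (C + of_nat n)))"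
        unfolding H_def diffs pE y1 y'' a_def b_def ..
      moreover have "H (Suc m) = a * (A + of_nat m) * (b * (B + of_nat m)) * e * (y * (C + of_nat n))"
        unfolding H_def diffs y'' pochhammer_Suc [of _ m] a_def b_def e_def ..
      moreover have "F m = ch * (a * b * e * ((C + of_nat m) * y))"
        unfolding F_def diffs y1 y' a_def b_def e_def ch_def ..
      moreover have "G m = of_nat m * ch * (a * b * (e * (E + of_nat (Suc q))) * ((C + of_nat m) * y))"
        unfolding G_def diffs pE y1 y' a_def b_def ch_def of_nat_mult ..
      moreover have "G (Suc m) = ch * of_nat (Suc q) * (a * (A + of_nat m) * (b * (B + of_nat m)) * e * y)"
        unfolding G_def absorb diffs y' pochhammer_Suc [of _ m] a_def b_def e_def ch_def ..
      moreover have "(of_nat n :: 'a) = of_nat m + of_nat (Suc q)"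
        by (simp add: n)
      ultimately show ?thesis
        unfolding C_def ch_def [symmetric] by algebra
    qed
  qed
  have "(\<Sum>m\<le>Suc n. of_nat (Suc n choose m) * H m) = (\<Sum>m\<le>n. of_nat (n choose m) * (H m + H (Suc m)))"
    by (rule sum_Suc_choose)
  also have "\<dots> = (C - A + of_nat n) * (C - B + of_nat n) * (\<Sum>m\<le>n. F m) + (\<Sum>m\<le>n. G (Suc m) - G m)"
    by (simp add: step sum.distrib sum_distrib_left)
  also have "(\<Sum>m\<le>n. G (Suc m) - G m) = G (Suc n) - G 0"
    using sum_lessThan_telescope [of G "Suc n"] by (simp only: lessThan_Suc_atMost)
  also have "\<dots> = 0"
    by (simp add: G_def)
  also have "(\<Sum>m\<le>n. F m) = pochhammer (C - A) n * pochhammer (C - B) n"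
    using Suc.IH by (simp add: F_def)
  finally show ?case
    by (simp add: H_def pochhammer_Suc mult_ac)
qed simp

section \<open>The two one-dimensional integrals\<close>

text \<open>
  Absorbing the Pochhammer symbols shifts the Gamma factors to \<open>\<Gamma>(a + \<upsilon> n - it) \<Gamma>(d + r + it)\<close>. Their
  integral is the inverse transform at the origin, and the resulting power of 2 cancels the powers of 2
  in the coefficients. The remaining quotient \<open>\<Gamma>(a + d + \<upsilon> n + r) / \<Gamma>(a + d + \<upsilon> n)\<close> is the Pochhammer
  symbol at which Newton's formula is applied.
\<close>

lemma has_bochner_integral_t_factor:
  fixes a d :: real and \<upsilon> N s :: nat
  assumes a: "a > 0" and d: "d > 0" and \<upsilon>: "\<upsilon> \<ge> 1"
  shows "has_bochner_integral lborel
    (\<lambda>t. Gamma (of_real a - \<i> * of_real t) * Gamma (of_real d + \<i> * of_real t)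
       * of_real (2 powr (a + d))
       * (\<Sum>n=0..N. pochhammer (- of_nat N) n * pochhammer (of_real a - \<i> * of_real t) (\<upsilon> * n) * 2 ^ (\<upsilon> * n)
             / (Gamma (of_real (a + d) + of_nat (\<upsilon> * n)) * fact n))
       * (\<Sum>j=0..s. \<Sum>r=0..j. \<Sum>m=0..r.
             pochhammer (- of_nat r) m * pochhammer (of_real d + \<i> * of_real t) r * 2 ^ r
             / (fact j * fact r * fact m) * pochhammer ((of_real (a + d) + of_nat m) / of_nat \<upsilon>) j))
    (2 * of_real pi * (if N \<le> s then 1 else 0))"
proof -
  define AD where "AD = complex_of_real (a + d)"
  define \<phi> where "\<phi> = (\<lambda>t. Gamma (of_real a - \<i> * of_real t) * Gamma (of_real d + \<i> * of_real t))"
  define \<psi> where "\<psi> = (\<lambda>n r t. Gamma (of_real (a + real n) - \<i> * of_real t) * Gamma (of_real (d + real r) + \<i> * of_real t))"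
  define p where "p = (\<lambda>n t. pochhammer (- of_nat N) n * pochhammer (of_real a - \<i> * of_real t) (\<upsilon> * n) * 2 ^ (\<upsilon> * n)
             / (Gamma (AD + of_nat (\<upsilon> * n)) * fact n))"
  define q where "q = (\<lambda>j r m t. pochhammer (- of_nat r) m * pochhammer (of_real d + \<i> * of_real t) r * 2 ^ r
             / (fact j * fact r * fact m) * pochhammer ((AD + of_nat m) / of_nat \<upsilon>) j)"
  define \<kappa> where "\<kappa> = (\<lambda>n j r m. of_real (2 powr (a + d)) * (pochhammer (- of_nat N) n * 2 ^ (\<upsilon> * n) / (Gamma (AD + of_nat (\<upsilon> * n)) * fact n))
       * (pochhammer (- of_nat r) m * 2 ^ r / (fact j * fact r * fact m) * pochhammer ((AD + of_nat m) / of_nat \<upsilon>) j))"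
  define val where "val = (\<lambda>n j r m. 2 * of_real pi * (pochhammer (- of_nat N) n / fact n *
     (pochhammer (AD + of_nat \<upsilon> * of_nat n) r / fact r * (pochhammer (- of_nat r) m / fact m * pochhammer ((AD + of_nat m) / of_nat \<upsilon>) j) / fact j)))"
  have \<psi>: "has_bochner_integral lborel (\<psi> n r) (of_real (2 * pi * Gamma (a + d + real n + real r) * 2 powr (- (a + d + real n + real r))))" for n r
    using has_bochner_integral_Gamma_iexp [of "a + real n" "d + real r" 0] a d
    by (simp add: \<psi>_def add_ac)
  have int: "has_bochner_integral lborel (\<lambda>t. \<phi> t * of_real (2 powr (a + d)) * p n t * q j r m t) (val n j r m)" for n j r m
  proof -
    have eq: "\<phi> t * of_real (2 powr (a + d)) * p n t * q j r m t = \<kappa> n j r m * \<psi> (\<upsilon> * n) r t" for t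
    proof -
      have "Gamma (of_real (a + real (\<upsilon> * n)) - \<i> * of_real t)
              = Gamma (of_real a - \<i> * of_real t) * pochhammer (of_real a - \<i> * of_real t) (\<upsilon> * n)"
        using Gamma_mult_pochhammer_complex [of "of_real a - \<i> * of_real t" "\<upsilon> * n"] a by (simp add: algebra_simps)
      moreover have "Gamma (of_real (d + real r) + \<i> * of_real t)
              = Gamma (of_real d + \<i> * of_real t) * pochhammer (of_real d + \<i> * of_real t) r"
        using Gamma_mult_pochhammer_complex [of "of_real d + \<i> * of_real t" r] d by (simp add: algebra_simps)
      ultimately have "\<psi> (\<upsilon> * n) r t
          = \<phi> t * pochhammer (of_real a - \<i> * of_real t) (\<upsilon> * n) * pochhammer (of_real d + \<i> * of_real t) r"
        unfolding \<psi>_def \<phi>_def by simp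
      then show ?thesis
        by (simp add: p_def q_def \<kappa>_def)
    qed
    have val: "\<kappa> n j r m * of_real (2 * pi * Gamma (a + d + real (\<upsilon> * n) + real r) * 2 powr (- (a + d + real (\<upsilon> * n) + real r)))
            = val n j r m"
    proof -
      define x where "x = a + d + real (\<upsilon> * n)"
      have x: "x > 0"
        using a d by (simp add: x_def add_pos_nonneg)
      have "Gamma x \<noteq> 0"
        using x by (rule Gamma_real_nonzero)
      have X: "AD + of_nat (\<upsilon> * n) = of_real x" "AD + of_nat \<upsilon> * of_nat n = of_real x"
        by (simp_all add: AD_def x_def)
      have pow: "2 powr (a + d) * 2 ^ (\<upsilon> * n) * 2 ^ r * 2 powr (- (x + real r)) = 1"
        by (simp add: x_def flip: powr_realpow powr_add)
      have G: "Gamma (x + real r) = Gamma x * pochhammer x r"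
        using Gamma_mult_pochhammer_real [OF x, of r] by simp
      define w where "w = complex_of_real (2 powr (a + d)) * 2 ^ (\<upsilon> * n) * 2 ^ r * of_real (2 powr (- (x + real r)))"
      have "w = of_real (2 powr (a + d) * 2 ^ (\<upsilon> * n) * 2 ^ r * 2 powr (- (x + real r)))"
        by (simp add: w_def)
      then have "w = 1"
        unfolding pow by simp
      have "\<kappa> n j r m * of_real (2 * pi * Gamma (x + real r) * 2 powr (- (x + real r))) = val n j r m * w"
        unfolding \<kappa>_def val_def X G w_def using \<open>Gamma x \<noteq> 0\<close>
        by (simp add: Gamma_complex_of_real pochhammer_of_real mult_ac)
      then show ?thesis
        using \<open>w = 1\<close> by (simp add: x_def)
    qed
    show ?thesis
      unfolding eq val [symmetric] by (intro has_bochner_integral_mult_right \<psi>)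
  qed
  have "has_bochner_integral lborel
     (\<lambda>t. \<Sum>n=0..N. \<Sum>j=0..s. \<Sum>r=0..j. \<Sum>m=0..r. \<phi> t * of_real (2 powr (a + d)) * p n t * q j r m t)
     (\<Sum>n=0..N. \<Sum>j=0..s. \<Sum>r=0..j. \<Sum>m=0..r. val n j r m)"
    by (intro has_bochner_integral_sum int)
  moreover have "(\<Sum>n=0..N. \<Sum>j=0..s. \<Sum>r=0..j. \<Sum>m=0..r. \<phi> t * of_real (2 powr (a + d)) * p n t * q j r m t)
         = \<phi> t * of_real (2 powr (a + d)) * (\<Sum>n=0..N. p n t) * (\<Sum>j=0..s. \<Sum>r=0..j. \<Sum>m=0..r. q j r m t)" for t
  proof -
    define Q where "Q = (\<Sum>j=0..s. \<Sum>r=0..j. \<Sum>m=0..r. q j r m t)"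
    have "\<phi> t * of_real (2 powr (a + d)) * (\<Sum>n=0..N. p n t) * Q
            = (\<Sum>n=0..N. \<phi> t * of_real (2 powr (a + d)) * p n t * Q)"
      unfolding sum_distrib_left sum_distrib_right ..
    then show ?thesis
      unfolding Q_def sum_distrib_left ..
  qed
  moreover have "(\<Sum>n=0..N. \<Sum>j=0..s. \<Sum>r=0..j. \<Sum>m=0..r. val n j r m) = 2 * of_real pi * (if N \<le> s then 1 else 0)"
  proof -
    have "of_nat \<upsilon> \<noteq> (0 :: complex)"
      using \<upsilon> by simp
    from sum_konhauser_biorthogonality [OF this, of N AD s] show ?thesis
      unfolding val_def by (simp only: flip: sum_distrib_left sum_divide_distrib)
  qed
  ultimately show ?thesis
    by (simp only: \<phi>_def p_def q_def AD_def)
qed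

text \<open>
  The sum that Barnes' lemma produces in the variable \<open>z\<close>, with \<open>P = b + c\<close>: the Pfaff-Saalschuetz sum
  for \<open>A = 1/2 - S\<close>, \<open>B = P - 1 - M\<close>, \<open>E = 1/2 + M - n\<close>, where \<open>M\<close> will be \<open>K - l + S\<close>. With \<open>n\<close> and \<open>S\<close> the lower and upper halves of
  \<open>s\<close>, the parameters \<open>-n\<close> and \<open>1/2 - S\<close> are \<open>-s/2\<close> and \<open>(1 - s)/2\<close> in some order.
\<close>

lemma saalschuetz_Gamma_sum:
  fixes P :: real and n S M :: nat
  assumes "n \<le> M" and P: "P - 1 - real M > 0" "P > real (n + S)"
  shows "(\<Sum>m\<le>n. pochhammer (- real n) m * pochhammer (1/2 - real S) m * (-1) ^ m
             / (pochhammer (P - real (n + S)) m * fact m)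
             * (Gamma (P - 1 - real M + real m) * Gamma (1/2 + real M - real m)))
         = Gamma (P - 1 - real M) * Gamma (1/2 + real M - real n)
             * pochhammer (P - 1/2 - real n) n * pochhammer (1 + real M - real (n + S)) n
             / pochhammer (P - real (n + S)) n"
proof -
  define A where "A = 1/2 - real S"
  define B where "B = P - 1 - real M"
  define E where "E = 1/2 + real M - real n"
  define C where "C = A + B + E"
  have C: "C = P - real (n + S)"
    by (simp add: A_def B_def C_def E_def)
  have pos: "B > 0" "E > 0" "C > 0"
    using assms unfolding C by (auto simp: B_def E_def)
  then have Cn: "pochhammer C k \<noteq> 0" for k
    using pochhammer_pos [of C k] by simp
  have summand: "pochhammer (- real n) m * pochhammer A m * (-1) ^ m / (pochhammer C m * fact m)
               * (Gamma (B + real m) * Gamma (1/2 + real M - real m))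
      = Gamma B * Gamma E / pochhammer C n
          * (of_nat (n choose m) * (pochhammer A m * pochhammer B m
             * pochhammer E (n - m) * pochhammer (C + of_nat m) (n - m)))" if "m \<le> n" for m
  proof -
    have "pochhammer (- real n) m / fact m = (-1) ^ m * of_nat (n choose m)"
      using pochhammer_minus_over_fact [of "real n" m] by (simp add: binomial_gbinomial)
    then have "pochhammer (- real n) m * (-1) ^ m = of_nat (n choose m) * fact m"
      by (simp add: field_simps)
    moreover have "Gamma (B + real m) = Gamma B * pochhammer B m"
      using Gamma_mult_pochhammer_real [OF pos(1)] by simp
    moreover have "Gamma (1/2 + real M - real m) = Gamma E * pochhammer E (n - m)"
      using Gamma_mult_pochhammer_real [OF pos(2), of "n - m"] that by (simp add: E_def of_nat_diff algebra_simps)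
    moreover have "pochhammer C n = pochhammer C m * pochhammer (C + of_nat m) (n - m)"
      using pochhammer_product [OF that, of C] .
    ultimately show ?thesis
      using Cn [of m] Cn [of n] by (simp add: field_simps)
  qed
  have "(\<Sum>m\<le>n. pochhammer (- real n) m * pochhammer A m * (-1) ^ m / (pochhammer C m * fact m)
               * (Gamma (B + real m) * Gamma (1/2 + real M - real m)))
     = Gamma B * Gamma E / pochhammer C n * (pochhammer (C - A) n * pochhammer (C - B) n)"
    unfolding C_def Pfaff_Saalschuetz [of n A B E, symmetric] sum_distrib_left
    by (intro sum.cong refl, subst summand [unfolded C_def]) auto
  then show ?thesis
    unfolding C unfolding A_def B_def E_def by (simp add: algebra_simps)
qed

text \<open>
  After the shift of arguments the \<open>m\<close>-th term is a Barnes integral in \<open>z/2\<close>. Of the four pair sums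
  of its parameters, the two that give \<open>b - 1/4\<close> and \<open>c - 1/4\<close> do not depend on \<open>m\<close>, and the other two
  give the Gamma factors of the preceding lemma.
\<close>

lemma has_bochner_integral_z_factor:
  fixes b c :: real and K S l n :: nat
  defines "w \<equiv> \<lambda>z::real. \<i> * of_real z / 2"
  defines "M \<equiv> K - l + S"
  defines "\<beta> \<equiv> \<lambda>m. pochhammer (- real n) m * pochhammer (1/2 - real S) m
                        / (pochhammer (b + c - real (n + S)) m * fact m)"
  assumes l: "l \<le> K" and n: "n \<le> S" and b: "b > real K + 1/2" and c: "c > real S + 1/2"
    and bc: "b + c > real (n + S)"
  shows "has_bochner_integral lborel
    (\<lambda>z. Gamma (1/4 - w z) * Gamma (of_real b - 1/2 + w z)
        * (pochhammer (1/4 - w z) K / pochhammer (3/2 - of_real b - w z) K)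
        * (pochhammer (of_real b - of_nat K - 1/2 + w z) l / pochhammer (3/4 - of_nat K + w z) l)
        * (Gamma (1/4 + w z) * Gamma (of_real c - 1/2 - w z)
        * (pochhammer (1/4 + w z) S / pochhammer (3/2 - of_real c + w z) S)
        * (\<Sum>m\<le>n. of_real (\<beta> m) * (pochhammer (of_real c - of_nat S - 1/2 - w z) m
                                        / pochhammer (3/4 - of_nat S - w z) m))))
    (of_real ((-1) ^ (K + l + S) * (4 * pi * Gamma (b - 1/4) * Gamma (c - 1/4) / Gamma (b + c - 1/2))
        * (Gamma (b + c - 1 - real M) * Gamma (1/2 + real M - real n)
             * pochhammer (b + c - 1/2 - real n) n * pochhammer (1 + real M - real (n + S)) n
             / pochhammer (b + c - real (n + S)) n)))"
proof -
  have Re_w: "Re (w z) = 0" for z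
    by (simp add: w_def)
  define \<Phi> where "\<Phi> = (\<lambda>m z. Gamma (1/4 + of_nat K - of_nat l - w z) * Gamma (of_real b - 1/2 - of_nat K + of_nat l + w z)
        * (Gamma (of_real c - 1/2 - of_nat S + of_nat m - w z) * Gamma (1/4 + of_nat S - of_nat m + w z)))"
  define G where "G = 4 * pi * Gamma (b - 1/4) * Gamma (c - 1/4) / Gamma (b + c - 1/2)"
  define q where "q = (\<lambda>m. Gamma (b + c - 1 - real M + real m) * Gamma (1/2 + real M - real m))"
  have M: "real M = real K - real l + real S"
    using l by (simp add: M_def)
  have \<Phi>: "has_bochner_integral lborel (\<Phi> m) (of_real (G * q m))" if m: "m \<le> n" for m
  proof -
    define A where "A = 1/4 + real K - real l"
    define D where "D = b - 1/2 - real K + real l"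
    define B where "B = c - 1/2 - real S + real m"
    define E where "E = 1/4 + real S - real m"
    have pos: "A > 0" "B > 0" "D > 0" "E > 0"
      using l n b c m by (auto simp: A_def B_def D_def E_def)
    have sums: "A + D = b - 1/4" "A + E = 1/2 + real M - real m" "B + D = b + c - 1 - real M + real m"
        "B + E = c - 1/4" "A + B + D + E = b + c - 1/2"
      by (simp_all add: A_def B_def D_def E_def M)
    have "has_bochner_integral lborel
      (\<lambda>z. Gamma (of_real A - \<i> * of_real (0 + 1/2 * z)) * Gamma (of_real D + \<i> * of_real (0 + 1/2 * z))
        * (Gamma (of_real B - \<i> * of_real (0 + 1/2 * z)) * Gamma (of_real E + \<i> * of_real (0 + 1/2 * z))))
      (of_real (2 * pi * Gamma (A + D) * Gamma (A + E) * Gamma (B + D) * Gamma (B + E) / Gamma (A + B + D + E)) /\<^sub>R \<bar>1/2\<bar>)"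
      using Barnes_first_lemma [OF pos]
      by (subst (asm) lborel_has_bochner_integral_real_affine_iff [of "1/2" _ _ 0]) simp_all
    then show ?thesis
      unfolding sums
      by (simp add: \<Phi>_def w_def A_def B_def D_def E_def G_def q_def scaleR_conv_of_real mult_ac)
  qed
  have sgn: "(-1) ^ (K + l) * (-1) ^ (S + m) = (-1) ^ (K + l + S) * (-1 :: complex) ^ m" for m
    by (simp add: power_add mult_ac)
  have shift: "Gamma (1/4 - w z) * Gamma (of_real b - 1/2 + w z)
        * (pochhammer (1/4 - w z) K / pochhammer (3/2 - of_real b - w z) K)
        * (pochhammer (of_real b - of_nat K - 1/2 + w z) l / pochhammer (3/4 - of_nat K + w z) l)
        * (Gamma (1/4 + w z) * Gamma (of_real c - 1/2 - w z)
        * (pochhammer (1/4 + w z) S / pochhammer (3/2 - of_real c + w z) S)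
        * (\<Sum>m\<le>n. of_real (\<beta> m) * (pochhammer (of_real c - of_nat S - 1/2 - w z) m
                                        / pochhammer (3/4 - of_nat S - w z) m)))
     = (\<Sum>m\<le>n. (of_real ((-1) ^ (K + l + S) * (\<beta> m * (-1) ^ m))) * \<Phi> m z)" for z
  proof -
    have args: "1 - (of_real b - 1/2 + w z) = 3/2 - of_real b - w z"
        "of_real b - 1/2 + w z - of_nat K = of_real b - of_nat K - 1/2 + w z"
        "1 - (1/4 - w z) - of_nat K = 3/4 - of_nat K + w z"
        "1 - (of_real c - 1/2 - w z) = 3/2 - of_real c + w z"
        "of_real c - 1/2 - w z - of_nat S = of_real c - of_nat S - 1/2 - w z"
        "1 - (1/4 + w z) - of_nat S = 3/4 - of_nat S - w z"
      by (simp_all add: field_simps)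
    have 1: "Gamma (1/4 - w z) * Gamma (of_real b - 1/2 + w z)
        * (pochhammer (1/4 - w z) K / pochhammer (3/2 - of_real b - w z) K)
        * (pochhammer (of_real b - of_nat K - 1/2 + w z) l / pochhammer (3/4 - of_nat K + w z) l)
       = (-1) ^ (K + l) * (Gamma (1/4 + of_nat K - of_nat l - w z) * Gamma (of_real b - 1/2 - of_nat K + of_nat l + w z))"
      using Gamma_ratio_shift [OF l, of "1/4 - w z" "of_real b - 1/2 + w z"] b Re_w [of z]
      unfolding args by (simp add: algebra_simps)
    have 2: "Gamma (1/4 + w z) * Gamma (of_real c - 1/2 - w z)
        * (pochhammer (1/4 + w z) S / pochhammer (3/2 - of_real c + w z) S)
        * (pochhammer (of_real c - of_nat S - 1/2 - w z) m / pochhammer (3/4 - of_nat S - w z) m)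
       = (-1) ^ (S + m) * (Gamma (of_real c - 1/2 - of_nat S + of_nat m - w z) * Gamma (1/4 + of_nat S - of_nat m + w z))"
      if "m \<le> n" for m
      using Gamma_ratio_shift [of m S "1/4 + w z" "of_real c - 1/2 - w z"] c Re_w [of z] that n
      unfolding args by (simp add: algebra_simps)
    show ?thesis
      unfolding 1 sum_distrib_left
    proof (intro sum.cong refl, goal_cases)
      case (1 m)
      then have m: "m \<le> n" by simp
      have regroup: "\<sigma> * X * (Y * (B * R)) = B * (\<sigma> * X) * (Y * R)" for \<sigma> X Y B R :: complex
        by simp
      have "B * ((-1) ^ (K + l) * X) * ((-1) ^ (S + m) * Y) = (-1) ^ (K + l + S) * (B * (-1) ^ m) * (X * Y)" for B X Y :: complex
      proof -
        have "p * q = r * u \<Longrightarrow> B * (p * X) * (q * Y) = r * (B * u) * (X * Y)" for p q r u :: complex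
          by algebra
        then show ?thesis
          using sgn [of m] by blast
      qed
      then show ?case
        unfolding regroup 2 [OF m] \<Phi>_def by simp
    qed
  qed
  have "has_bochner_integral lborel (\<lambda>z. \<Sum>m\<le>n. of_real ((-1) ^ (K + l + S) * (\<beta> m * (-1) ^ m)) * \<Phi> m z)
          (\<Sum>m\<le>n. of_real ((-1) ^ (K + l + S) * (\<beta> m * (-1) ^ m)) * of_real (G * q m))"
    by (intro has_bochner_integral_sum has_bochner_integral_mult_right \<Phi>) simp
  moreover have "(\<Sum>m\<le>n. of_real ((-1) ^ (K + l + S) * (\<beta> m * (-1) ^ m)) * of_real (G * q m))
      = complex_of_real ((-1) ^ (K + l + S) * G * (\<Sum>m\<le>n. \<beta> m * (-1) ^ m * q m))"
    unfolding sum_distrib_left of_real_sum by (intro sum.cong refl) (simp add: mult_ac)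
  moreover have "(\<Sum>m\<le>n. \<beta> m * (-1) ^ m * q m)
       = Gamma (b + c - 1 - real M) * Gamma (1/2 + real M - real n)
             * pochhammer (b + c - 1/2 - real n) n * pochhammer (1 + real M - real (n + S)) n
             / pochhammer (b + c - real (n + S)) n"
    using saalschuetz_Gamma_sum [of n M "b + c" S] n b c bc l
    by (simp add: \<beta>_def q_def M) (simp add: M_def)
  ultimately show ?thesis
    unfolding shift by (simp only: G_def)
qed

text \<open>
  Which of \<open>-s/2\<close> and \<open>(1 - s)/2\<close> is an integer depends on the parity of \<open>s\<close>; naming the integer one
  \<open>- (s div 2)\<close> keeps the summation over \<open>m\<close> free of case distinctions.
\<close>

lemma half_pochhammers:
  "pochhammer (- of_nat s / 2) m * pochhammer ((- of_nat s + 1) / 2) m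
     = complex_of_real (pochhammer (- real (s div 2)) m * pochhammer (1/2 - real ((s + 1) div 2)) m)"
proof (cases "even s")
  case True
  then obtain n where "s = 2 * n" by (elim evenE)
  then show ?thesis
    by (simp add: pochhammer_of_real [symmetric] diff_divide_distrib)
next
  case False
  then obtain n where "s = 2 * n + 1" by (elim oddE)
  then have "- of_nat s / 2 = (1/2 - of_nat ((s + 1) div 2) :: complex)" "(- of_nat s + 1) / 2 = (- of_nat (s div 2) :: complex)"
    by (simp_all add: field_simps)
  then show ?thesis
    by (simp add: pochhammer_of_real [symmetric] mult.commute)
qed

text \<open>
  At \<open>(iz, it)\<close> the arguments of \<open>Psi1\<close> are the real numbers \<open>z\<close> and \<open>t\<close>. The sum over \<open>n\<close> is isolated,
  since apart from the power of 2 it is the only part that contains \<open>t\<close>.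
\<close>

lemma Upsilon1_imaginary_axis:
  fixes z t :: real
  defines "w \<equiv> \<i> * of_real z / 2"
  shows "Upsilon1 k a b c d \<upsilon> (\<i> * of_real z) (\<i> * of_real t) =
    2 powr (of_real a - \<i> * of_real t)
    * (pochhammer (1/4 - w) (k div 2) / pochhammer (3/2 - of_real b - w) (k div 2))
    * (\<Sum>l=0..k div 2. pochhammer (- of_nat k / 2) l * pochhammer ((- of_nat k + 1) / 2) l
           / (pochhammer (of_real (b + c) - of_nat k) l * fact l)
        * (pochhammer (of_real b - of_nat (k div 2) - 1/2 + w) l / pochhammer (3/4 - of_nat (k div 2) + w) l)
        * (\<Sum>n=0..k - l. pochhammer (- of_nat (k - l)) n * pochhammer (of_real a - \<i> * of_real t) (\<upsilon> * n) * 2 ^ (\<upsilon> * n)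
             / (Gamma (of_real (a + d) + of_nat (\<upsilon> * n)) * fact n)))"
proof -
  have arg: "- \<i> * (\<i> * of_real x) = (of_real x :: complex)" for x
    by simp
  show ?thesis
    unfolding Upsilon1_def Psi1_def arg w_def [symmetric] mult.assoc [of "2 powr _"] sum_distrib_left
    by (intro arg_cong2 [of _ _ _ _ "(*)"] arg_cong2 [of _ _ _ _ "(\<lambda>x y. x * y)"] sum.cong refl)
       (auto simp: of_nat_diff sum_distrib_left algebra_simps)
qed

text \<open>
  At \<open>(-iz, -it)\<close> the arguments of \<open>Psi2\<close> are \<open>-z\<close> and \<open>-t\<close>, which turns \<open>w\<close> into \<open>-w\<close>. Here the
  dependence on \<open>z\<close> and the dependence on \<open>t\<close> separate completely.
\<close>

lemma Upsilon2_imaginary_axis: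
  fixes z t :: real
  defines "w \<equiv> \<i> * of_real z / 2"
  shows "Upsilon2 s d c b a \<upsilon> (- \<i> * of_real z) (- \<i> * of_real t) =
    2 powr (of_real d + \<i> * of_real t)
    * (pochhammer (1/4 + w) ((s + 1) div 2) / pochhammer (3/2 - of_real c + w) ((s + 1) div 2))
    * (\<Sum>m\<le>s div 2. of_real (pochhammer (- real (s div 2)) m * pochhammer (1/2 - real ((s + 1) div 2)) m
                        / (pochhammer (b + c - real s) m * fact m))
        * (pochhammer (of_real c - of_nat ((s + 1) div 2) - 1/2 - w) m / pochhammer (3/4 - of_nat ((s + 1) div 2) - w) m))
    * (\<Sum>j=0..s. \<Sum>r=0..j. \<Sum>m=0..r.
             pochhammer (- of_nat r) m * pochhammer (of_real d + \<i> * of_real t) r * 2 ^ r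
             / (fact j * fact r * fact m) * pochhammer ((of_real (a + d) + of_nat m) / of_nat \<upsilon>) j)"
proof -
  have args: "1/4 - \<i> * (- \<i> * (- \<i> * of_real z)) / 2 = 1/4 + w" "u - \<i> * (- \<i> * (- \<i> * of_real z)) / 2 = u + w"
      "u + \<i> * (- \<i> * (- \<i> * of_real z)) / 2 = u - w" "u - \<i> * (- \<i> * (- \<i> * of_real t)) = u + \<i> * of_real t"
      "u - (- \<i> * of_real t) = u + \<i> * of_real t" "of_real (d + a - 1) + u + 1 = of_real (a + d) + u" for u
    by (simp_all add: w_def)
  show ?thesis
    unfolding Upsilon2_def Psi2_def args half_pochhammers atMost_atLeast0 [symmetric]
    by (simp add: pochhammer_of_real [symmetric] add.commute [of c b] mult_ac)
qed

text \<open>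
  The duplication formula pairs the factors that differ by one half: \<open>\<Gamma>(1/2 + S)\<close> with \<open>K!\<close>, which gives
  \<open>k!\<close>, and \<open>\<Gamma>(P - S)\<close> with \<open>\<Gamma>(P - 1/2 - K)\<close>, which gives \<open>\<Gamma>(2P - k - 1)\<close>. The parity of \<open>k\<close> only decides
  which member of each pair is the smaller one.
\<close>

lemma diagonal_constant:
  fixes P X :: real and k :: nat
  defines "K \<equiv> k div 2" and "S \<equiv> (k + 1) div 2"
  assumes P: "P > real k + 1"
  shows "(-1) ^ (K + S) * (4 * pi * X / Gamma (P - 1/2))
        * (Gamma (P - 1 - real k) * Gamma (1/2 + real k - real K)
             * pochhammer (P - 1/2 - real K) K * fact K / pochhammer (P - real k) K) * (2 * pi)
       = (-1) ^ k * 2 powr (2 * (P - real k) + 1) * pi\<^sup>2 * fact k * (Gamma (P - real k))\<^sup>2 * X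
           / ((P - real k - 1) * Gamma (2 * P - real k - 1))"
proof -
  have KS: "K + S = k"
    unfolding K_def S_def by presburger
  then have S: "real S = real k - real K"
    by linarith
  have "K \<le> k" "S \<le> k"
    using KS by auto
  have eo: "(S = K \<and> real k = 2 * real K) \<or> (S = K + 1 \<and> real k = 2 * real K + 1)"
    using KS by (cases "even k") (auto simp: K_def S_def elim!: evenE oddE)
  have G1: "pochhammer (P - 1/2 - real K) K = Gamma (P - 1/2) / Gamma (P - 1/2 - real K)"
    using Gamma_mult_pochhammer_real [of "P - 1/2 - real K" K] P \<open>K \<le> k\<close> Gamma_real_nonzero [of "P - 1/2 - real K"]
    by (simp add: field_simps)
  have G2: "pochhammer (P - real k) K = Gamma (P - real S) / Gamma (P - real k)"
    using Gamma_mult_pochhammer_real [of "P - real k" K] P Gamma_real_nonzero [of "P - real k"]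
    by (simp add: field_simps S)
  have G3: "Gamma (P - real k) = (P - real k - 1) * Gamma (P - 1 - real k)"
  proof -
    have "P - 1 - real k \<notin> \<int>\<^sub>\<le>\<^sub>0"
      using P by (auto elim!: nonpos_Ints_cases)
    from Gamma_plus1 [OF this] show ?thesis
      by (simp add: algebra_simps)
  qed
  have G4: "Gamma (1/2 + real k - real K) * fact K = 2 powr (- real k) * sqrt pi * fact k"
  proof -
    have "Gamma (1/2 + real S) * Gamma (real K + 1) = 2 powr (- real k) * sqrt pi * Gamma (real k + 1)"
    proof -
      define x where "x = (real k + 1) / 2"
      have "Gamma x * Gamma (x + 1/2) = 2 powr (- real k) * sqrt pi * Gamma (real k + 1)"
      proof -
        have x: "x > 0" "1 - 2 * x = - real k" "2 * x = real k + 1"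
          by (simp_all add: x_def field_simps)
        show ?thesis
          using Gamma_duplication_real [OF x(1)] unfolding x(2) unfolding x(3) .
      qed
      moreover have "x = 1/2 + real S \<and> x + 1/2 = real K + 1 \<or> x = real K + 1 \<and> x + 1/2 = 1/2 + real S"
        using eo by (auto simp: x_def field_simps)
      ultimately show ?thesis
        by (auto simp: mult.commute add.commute)
    qed
    then show ?thesis
      using Gamma_fact [of K, where 'a = real] Gamma_fact [of k, where 'a = real]
      by (simp add: S add_ac diff_add_eq)
  qed
  have G5: "Gamma (P - real S) * Gamma (P - 1/2 - real K) = 2 powr (real k + 2 - 2 * P) * sqrt pi * Gamma (2 * P - real k - 1)"
  proof -
    define x where "x = P - (real k + 1) / 2"
    have x: "x > 0" "1 - 2 * x = real k + 2 - 2 * P" "2 * x = 2 * P - real k - 1"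
      using P by (simp_all add: x_def field_simps)
    have "Gamma x * Gamma (x + 1/2) = 2 powr (real k + 2 - 2 * P) * sqrt pi * Gamma (2 * P - real k - 1)"
      using Gamma_duplication_real [OF x(1)] unfolding x(2) unfolding x(3) .
    moreover have "x = P - 1/2 - real K \<and> x + 1/2 = P - real S \<or> x = P - real S \<and> x + 1/2 = P - 1/2 - real K"
      using eo by (auto simp: x_def field_simps)
    ultimately show ?thesis
      by (metis mult.commute)
  qed
  have pow: "8 * 2 powr (- real k) = 2 powr (2 * (P - real k) + 1) * 2 powr (real k + 2 - 2 * P)"
  proof -
    have eight: "8 = 2 powr (3 :: real)"
      by simp
    show ?thesis
      unfolding eight powr_add [symmetric] by simp
  qed
  have pos: "P - real k - 1 > 0" "Gamma (P - 1/2) \<noteq> 0" "Gamma (P - 1/2 - real K) \<noteq> 0" "Gamma (P - real S) \<noteq> 0"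
      "Gamma (2 * P - real k - 1) \<noteq> 0" "Gamma (P - real k) \<noteq> 0"
    using P \<open>K \<le> k\<close> \<open>S \<le> k\<close> by (auto intro!: Gamma_real_nonzero)
  have "(-1) ^ (K + S) * (4 * pi * X / Gamma (P - 1/2))
        * (Gamma (P - 1 - real k) * Gamma (1/2 + real k - real K)
             * pochhammer (P - 1/2 - real K) K * fact K / pochhammer (P - real k) K) * (2 * pi)
     = (-1) ^ k * 8 * pi\<^sup>2 * X * Gamma (P - 1 - real k) * Gamma (P - real k)
         * (Gamma (1/2 + real k - real K) * fact K) / (Gamma (P - real S) * Gamma (P - 1/2 - real K))"
    unfolding KS G1 G2 using pos by (simp add: power2_eq_square mult_ac)
  also have "\<dots> = (-1) ^ k * (8 * 2 powr (- real k)) * pi\<^sup>2 * X * Gamma (P - 1 - real k) * Gamma (P - real k) * fact k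
        / (2 powr (real k + 2 - 2 * P) * Gamma (2 * P - real k - 1))"
    unfolding G4 G5 by simp
  also have "\<dots> = (-1) ^ k * 2 powr (2 * (P - real k) + 1) * pi\<^sup>2 * X * Gamma (P - 1 - real k) * Gamma (P - real k) * fact k
        / Gamma (2 * P - real k - 1)"
    unfolding pow by simp
  also have "\<dots> = (-1) ^ k * 2 powr (2 * (P - real k) + 1) * pi\<^sup>2 * fact k * (Gamma (P - real k))\<^sup>2 * X
           / ((P - real k - 1) * Gamma (2 * P - real k - 1))"
    using pos(1) unfolding power2_eq_square by (subst (3) G3) simp
  finally show ?thesis .
qed

section \<open>Biorthogonality\<close>

theorem theorem24:
  fixes \<upsilon> k s :: nat and a b c d :: real
  assumes "\<upsilon> \<ge> 1"
    and "even k \<longleftrightarrow> even s"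
    and "a > 0" and "d > 0"
    and "b > real (k div 2) + 1/2"
    and "c > real ((s + 1) div 2) + 1/2"
    and "b + c > real (max k s) + 1"
  shows "let F = (\<lambda>z t :: real.
               rho a b c d z t
               * Upsilon1 k a b c d \<upsilon> (\<i> * of_real z) (\<i> * of_real t)
               * Upsilon2 s d c b a \<upsilon> (- \<i> * of_real z) (- \<i> * of_real t));
             I = (LBINT z. LBINT t. F z t)
         in integrable (lborel \<Otimes>\<^sub>M lborel) (\<lambda>(z, t). F z t)
            \<and> I = complex_of_real
                  ((-1) ^ k * 2 powr (2 * (b + c - real k) + 1) * pi\<^sup>2 * fact k
                   * (Gamma (b + c - real k))\<^sup>2 * Gamma (b - 1/4) * Gamma (c - 1/4)
                   / ((b + c - real k - 1) * Gamma (2 * (b + c) - real k - 1)))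
                * (if k = s then 1 else 0)
            \<and> (I \<noteq> 0 \<longleftrightarrow> k = s)"
proof -
  define K S n where "K = k div 2" and "S = (s + 1) div 2" and "n = s div 2"
  have nS: "n + S = s" "n \<le> S"
    unfolding n_def S_def by presburger+
  define F where "F = (\<lambda>z t :: real. rho a b c d z t
               * Upsilon1 k a b c d \<upsilon> (\<i> * of_real z) (\<i> * of_real t)
               * Upsilon2 s d c b a \<upsilon> (- \<i> * of_real z) (- \<i> * of_real t))"
  define w where "w = (\<lambda>z::real. \<i> * of_real z / 2)"
  define \<alpha> where "\<alpha> = (\<lambda>l. pochhammer (- of_nat k / 2) l * pochhammer ((- of_nat k + 1) / 2) l
           / (pochhammer (of_real (b + c) - of_nat k) l * fact l) :: complex)"
  define \<beta> where "\<beta> = (\<lambda>m. pochhammer (- real n) m * pochhammer (1/2 - real S) m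
                        / (pochhammer (b + c - real (n + S)) m * fact m))"
  define Z where "Z = (\<lambda>l z. Gamma (1/4 - w z) * Gamma (of_real b - 1/2 + w z)
        * (pochhammer (1/4 - w z) K / pochhammer (3/2 - of_real b - w z) K)
        * (pochhammer (of_real b - of_nat K - 1/2 + w z) l / pochhammer (3/4 - of_nat K + w z) l)
        * (Gamma (1/4 + w z) * Gamma (of_real c - 1/2 - w z)
        * (pochhammer (1/4 + w z) S / pochhammer (3/2 - of_real c + w z) S)
        * (\<Sum>m\<le>n. of_real (\<beta> m) * (pochhammer (of_real c - of_nat S - 1/2 - w z) m
                                        / pochhammer (3/4 - of_nat S - w z) m))))"
  define T where "T = (\<lambda>N t. Gamma (of_real a - \<i> * of_real t) * Gamma (of_real d + \<i> * of_real t)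
       * of_real (2 powr (a + d))
       * (\<Sum>n=0..N. pochhammer (- of_nat N) n * pochhammer (of_real a - \<i> * of_real t) (\<upsilon> * n) * 2 ^ (\<upsilon> * n)
             / (Gamma (of_real (a + d) + of_nat (\<upsilon> * n)) * fact n))
       * (\<Sum>j=0..s. \<Sum>r=0..j. \<Sum>m=0..r.
             pochhammer (- of_nat r) m * pochhammer (of_real d + \<i> * of_real t) r * 2 ^ r
             / (fact j * fact r * fact m) * pochhammer ((of_real (a + d) + of_nat m) / of_nat \<upsilon>) j))"
  define R where "R = (\<lambda>l. (-1) ^ (K + l + S) * (4 * pi * Gamma (b - 1/4) * Gamma (c - 1/4) / Gamma (b + c - 1/2))
        * (Gamma (b + c - 1 - real (K - l + S)) * Gamma (1/2 + real (K - l + S) - real n)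
             * pochhammer (b + c - 1/2 - real n) n * pochhammer (1 + real (K - l + S) - real (n + S)) n
             / pochhammer (b + c - real (n + S)) n))"
  have F: "F z t = (\<Sum>l=0..K. \<alpha> l * (Z l z * T (k - l) t))" for z t
  proof -
    have two: "2 powr (of_real a - \<i> * of_real t) * 2 powr (of_real d + \<i> * of_real t) = complex_of_real (2 powr (a + d))"
      by (simp add: powr_of_real [symmetric] flip: powr_add)
    define p1 v where "p1 = pochhammer (1/4 - w z) K / pochhammer (3/2 - of_real b - w z) K"
      and "v = (\<lambda>l. pochhammer (of_real b - of_nat K - 1/2 + w z) l / pochhammer (3/4 - of_nat K + w z) l)"
    define p2 V where "p2 = pochhammer (1/4 + w z) S / pochhammer (3/2 - of_real c + w z) S"
      and "V = (\<Sum>m\<le>n. of_real (\<beta> m) * (pochhammer (of_real c - of_nat S - 1/2 - w z) m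
                                        / pochhammer (3/4 - of_nat S - w z) m))"
    define Q where "Q = (\<lambda>N. \<Sum>n=0..N. pochhammer (- of_nat N) n * pochhammer (of_real a - \<i> * of_real t) (\<upsilon> * n) * 2 ^ (\<upsilon> * n)
             / (Gamma (of_real (a + d) + of_nat (\<upsilon> * n)) * fact n) :: complex)"
    define U where "U = (\<Sum>j=0..s. \<Sum>r=0..j. \<Sum>m=0..r.
             pochhammer (- of_nat r) m * pochhammer (of_real d + \<i> * of_real t) r * 2 ^ r
             / (fact j * fact r * fact m) * pochhammer ((of_real (a + d) + of_nat m) / of_nat \<upsilon>) j)"
    have U1: "Upsilon1 k a b c d \<upsilon> (\<i> * of_real z) (\<i> * of_real t)
        = 2 powr (of_real a - \<i> * of_real t) * p1 * (\<Sum>l=0..K. \<alpha> l * v l * Q (k - l))"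
      unfolding Upsilon1_imaginary_axis p1_def v_def Q_def \<alpha>_def K_def w_def ..
    have U2: "Upsilon2 s d c b a \<upsilon> (- \<i> * of_real z) (- \<i> * of_real t)
        = 2 powr (of_real d + \<i> * of_real t) * p2 * V * U"
      unfolding p2_def V_def U_def \<beta>_def nS(1) w_def
      unfolding S_def n_def by (rule Upsilon2_imaginary_axis)
    have regroup: "X * (x1 * p1 * Y) * (x2 * p2 * V * U) = (x1 * x2) * (X * p1 * p2 * V * U) * Y"
      for X x1 p1 Y x2 p2 V U :: complex
      by simp
    have "F z t = of_real (2 powr (a + d)) * (rho a b c d z t * p1 * p2 * V * U) * (\<Sum>l=0..K. \<alpha> l * v l * Q (k - l))"
      unfolding F_def U1 U2 regroup two ..
    also have "\<dots> = (\<Sum>l=0..K. of_real (2 powr (a + d)) * (rho a b c d z t * p1 * p2 * V * U) * (\<alpha> l * v l * Q (k - l)))"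
      by (rule sum_distrib_left)
    also have "\<dots> = (\<Sum>l=0..K. \<alpha> l * (Z l z * T (k - l) t))"
    proof (intro sum.cong refl)
      fix l
      have "Z l z = Gamma (1/4 - w z) * Gamma (of_real b - 1/2 + w z) * p1 * v l
               * (Gamma (1/4 + w z) * Gamma (of_real c - 1/2 - w z) * p2 * V)"
        unfolding Z_def p1_def v_def p2_def V_def ..
      moreover have "T (k - l) t = Gamma (of_real a - \<i> * of_real t) * Gamma (of_real d + \<i> * of_real t)
               * of_real (2 powr (a + d)) * Q (k - l) * U"
        unfolding T_def Q_def U_def ..
      ultimately show "of_real (2 powr (a + d)) * (rho a b c d z t * p1 * p2 * V * U) * (\<alpha> l * v l * Q (k - l))
               = \<alpha> l * (Z l z * T (k - l) t)"
        unfolding rho_def w_def by (simp only: mult_ac)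
    qed
    finally show ?thesis .
  qed
  have Z: "has_bochner_integral lborel (Z l) (of_real (R l))" if "l \<le> K" for l
    unfolding Z_def R_def w_def \<beta>_def
    using assms nS that by (intro has_bochner_integral_z_factor) (auto simp: K_def S_def)
  have T: "has_bochner_integral lborel (T N) (2 * of_real pi * (if N \<le> s then 1 else 0))" for N
    unfolding T_def using assms by (intro has_bochner_integral_t_factor)
  have int: "integrable (lborel \<Otimes>\<^sub>M lborel) (\<lambda>(z, t). F z t)"
  proof -
    have "integrable (lborel \<Otimes>\<^sub>M lborel) (\<lambda>p. \<Sum>l=0..K. \<alpha> l * (case p of (z, t) \<Rightarrow> Z l z * T (k - l) t))"
      using Z T by (intro Bochner_Integration.integrable_sum integrable_mult_right integrable_pair_mult)
                   (auto simp: has_bochner_integral_iff)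
    moreover have "(\<lambda>p. \<Sum>l=0..K. \<alpha> l * (case p of (z, t) \<Rightarrow> Z l z * T (k - l) t)) = (\<lambda>(z, t). F z t)"
      unfolding F by (rule ext) (simp split: prod.split)
    ultimately show ?thesis
      by (simp only:)
  qed
  have "(LBINT t. F z t) = (\<Sum>l=0..K. \<alpha> l * (Z l z * (2 * of_real pi * (if k - l \<le> s then 1 else 0))))" for z
    unfolding F by (intro has_bochner_integral_integral_eq has_bochner_integral_sum has_bochner_integral_mult_right T)
  moreover have "(LBINT z. \<Sum>l=0..K. \<alpha> l * (Z l z * (2 * of_real pi * (if k - l \<le> s then 1 else 0))))
          = (\<Sum>l=0..K. \<alpha> l * (of_real (R l) * (2 * of_real pi * (if k - l \<le> s then 1 else 0))))"
    by (intro has_bochner_integral_integral_eq has_bochner_integral_sum has_bochner_integral_mult_right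
          has_bochner_integral_mult_left Z) simp
  ultimately have I: "(LBINT z. LBINT t. F z t)
          = (\<Sum>l=0..K. \<alpha> l * (of_real (R l) * (2 * of_real pi * (if k - l \<le> s then 1 else 0))))"
    by simp
  \<comment> \<open>The terms with \<open>k - l > s\<close> are killed by the integral over \<open>t\<close>, all others, except \<open>l = 0\<close> for \<open>k = s\<close>, by the integral over \<open>z\<close>.\<close>
  have vanish: "R l = 0" if l: "l \<le> K" and "k - l \<le> s" "\<not> (k = s \<and> l = 0)" for l
  proof -
    have "K + 1 \<le> n + l"
    proof -
      have "k = 2 * K + k mod 2" "s = 2 * n + s mod 2" "k mod 2 = s mod 2" "k \<le> s + l"
        using assms(2) that by (auto simp: K_def n_def mod2_eq_if)
      then show ?thesis
        using that(3) by (cases "l = 0") linarith+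
    qed
    then have "1 + real (K - l + S) - real (n + S) = - of_nat (n + l - (K + 1))" "n + l - (K + 1) < n"
      using l by (auto simp: of_nat_diff)
    then have "pochhammer (1 + real (K - l + S) - real (n + S)) n = 0"
      unfolding pochhammer_eq_0_iff by blast
    then show ?thesis
      by (simp add: R_def)
  qed
  define V where "V = (-1) ^ k * 2 powr (2 * (b + c - real k) + 1) * pi\<^sup>2 * fact k
                   * (Gamma (b + c - real k))\<^sup>2 * Gamma (b - 1/4) * Gamma (c - 1/4)
                   / ((b + c - real k - 1) * Gamma (2 * (b + c) - real k - 1))"
  have value_I: "(LBINT z. LBINT t. F z t) = complex_of_real V * (if k = s then 1 else 0)"
  proof (cases "k = s")
    case False
    then have "(LBINT z. LBINT t. F z t) = 0"
      unfolding I by (intro sum.neutral) (auto simp: vanish)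
    then show ?thesis using False by simp
  next
    case True
    have K: "n = K" "K - 0 + S = k" "K + 0 + S = k" "K + S = k"
      using True nS by (simp_all add: K_def n_def)
    have X: "4 * pi * Gamma (b - 1/4) * Gamma (c - 1/4) = 4 * pi * (Gamma (b - 1/4) * Gamma (c - 1/4))"
      by simp
    have "pochhammer (1 + real k - real k) K = fact K"
      by (simp add: pochhammer_fact)
    then have R0: "R 0 = (-1) ^ (K + S) * (4 * pi * (Gamma (b - 1/4) * Gamma (c - 1/4)) / Gamma (b + c - 1/2))
        * (Gamma (b + c - 1 - real k) * Gamma (1/2 + real k - real K)
             * pochhammer (b + c - 1/2 - real K) K * fact K / pochhammer (b + c - real k) K)"
      unfolding R_def K X by (simp only:)
    have "(LBINT z. LBINT t. F z t) = (\<Sum>l\<in>{0}. \<alpha> l * (of_real (R l) * (2 * of_real pi * (if k - l \<le> s then 1 else 0))))"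
      unfolding I by (rule sum.mono_neutral_right) (auto simp: vanish)
    also have "\<dots> = of_real (R 0 * (2 * pi))"
      using True by (simp add: \<alpha>_def)
    also have "R 0 * (2 * pi) = V"
    proof -
      have "S = (k + 1) div 2"
        using True by (simp add: S_def)
      with diagonal_constant [of k "b + c" "Gamma (b - 1/4) * Gamma (c - 1/4)"] assms(7) True
      have "R 0 * (2 * pi) = (-1) ^ k * 2 powr (2 * (b + c - real k) + 1) * pi\<^sup>2 * fact k * (Gamma (b + c - real k))\<^sup>2
           * (Gamma (b - 1/4) * Gamma (c - 1/4)) / ((b + c - real k - 1) * Gamma (2 * (b + c) - real k - 1))"
        unfolding R0 K_def by fastforce
      then show ?thesis
        by (simp only: V_def mult.assoc)
    qed
    finally show ?thesis
      using True by simp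
  qed
  have "V \<noteq> 0"
  proof -
    have "b > 1/2" "c > 1/2" "b + c > real k + 1"
      using assms by auto
    then have "Gamma (b + c - real k) \<noteq> 0" "Gamma (b - 1/4) \<noteq> 0" "Gamma (c - 1/4) \<noteq> 0"
        "Gamma (2 * (b + c) - real k - 1) \<noteq> 0" "b + c - real k - 1 \<noteq> 0"
      by (auto intro!: Gamma_real_nonzero)
    then show ?thesis
      by (simp add: V_def del: distrib_left_numeral)
  qed
  have fold_F: "rho a b c d z t * Upsilon1 k a b c d \<upsilon> (\<i> * of_real z) (\<i> * of_real t)
               * Upsilon2 s d c b a \<upsilon> (- \<i> * of_real z) (- \<i> * of_real t) = F z t" for z t
    by (simp only: F_def)
  show ?thesis
    unfolding Let_def fold_F V_def [symmetric] value_I using int \<open>V \<noteq> 0\<close> by simp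
qed

end
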